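(* Let $a, d_1,\dots,d_k$ be positive integers such that the generalized Douglas region $D_a(d_1,\dots,d_k)$ (defined in the context) has width $w$ and has its western and eastern vertices $D$ and $B$ on the same horizontal line. Then the number of tilings of $D_a(d_1,\dots,d_k)$ is $$\operatorname{M}(D_a(d_1,\dots,d_k)) = 2^{\mathcal{C}-w(w+1)/2},$$ where $\mathcal{C}$ is the number of regular cells of the region.
   Context: Work in the square lattice in which some southwest-to-northeast lattice diagonals are "drawn in"; each unit square crossed by a drawn-in diagonal is cut into two triangles. The resulting pieces (uncut unit squares and triangles) are the fundamental regions. A tile is a union of two fundamental regions sharing an edge, a tiling of a region is a covering by tiles without gaps or overlaps, and $\operatorname{M}(R)$ is the number of tilings of $R$. Distances between diagonals are measured in units of $\sqrt2/2$, the distance between consecutive lattice diagonals. Construction of $D_a(d_1,\dots,d_k)$: fix two southwest-to-northeast lattice diagonals $\ell$ (upper) and $\ell'$ (lower), neither drawn in, and draw in $k-1$ diagonals strictly between them so that the distance from $\ell$ to the top drawn-in diagonal is $d_1$, the distances between successive drawn-in diagonals (from the top) are $d_2,\dots,d_{k-1}$, and the distance from the bottom drawn-in diagonal to $\ell'$ is $d_k$. Color the fundamental regions black and white so that regions sharing an edge have opposite colors and the unit squares passed through by $\ell$ are white. Let $A$ be a lattice point on $\ell$; starting from $A$, take unit steps south or east such that at each step the fundamental region on the left of the step is black, until reaching $\ell'$ at a lattice point $B$; this path is the northeastern boundary. Let $D$ be the lattice point on $\ell$ at distance $a\sqrt2$ southwest of $A$. The southwestern boundary is the reflection of the northeastern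 boundary in the perpendicular bisector of $AD$ (with step directions reversed), running from $C$ to $D$, where $C$ (on $\ell'$) is the reflection of $B$. Join $D$ to $A$ by a zigzag path of alternating east and north unit steps with the squares passed through by $\ell$ on its right, and join $B$ to $C$ by a similar zigzag path with the squares passed through by $\ell'$ on its right. The region bounded by these four paths is $D_a(d_1,\dots,d_k)$. It is assumed that $\ell'$ passes through white unit squares and that the northeastern and southwestern boundaries do not intersect. The fundamental regions inside the region are cells. Triangular cells point towards $\ell'$ ("down-pointing") or away from $\ell'$ ("up-pointing"). A cell is regular if it is a black square or a black up-pointing triangle. The width of the region is $|BC|/\sqrt2$, which equals the number of white squares in the bottom row of square cells (the row of square cells passed through by the lowest lattice diagonal meeting the region in squares).
   Formalization: Along the northeastern boundary from A to B, the black fundamental region is required on the southwestern (inner) side of each step, not on the left of the direction of travel; with the latter, white cells always outnumber black ones and there are no tilings. *)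

theory Defs
  imports "HOL-Analysis.Product_Vector" "HOL-Library.Disjoint_Sets"
begin

section \<open>Fundamental regions\<close>

type_synonym point = "int \<times> int"
type_synonym edge = "point set"

text \<open>
  A piece is given by the lower left corner of the unit square it lies in: the whole square, or
  one of the two triangles cut off by its southwest-to-northeast diagonal. \<open>Up\<close> is the northwestern
  triangle, which points away from the lower line \<open>\<ell>'\<close>; \<open>Down\<close> is the southeastern one.
\<close>

datatype piece = Square point | Up point | Down point

primrec corner :: "piece \<Rightarrow> point" where
  "corner (Square p) = p"
| "corner (Up p) = p"
| "corner (Down p) = p"

fun edges :: "piece \<Rightarrow> edge set" where
  "edges (Square (i, j)) =
     {{(i, j), (i, j + 1)}, {(i, j + 1), (i + 1, j + 1)},
      {(i, j), (i + 1, j)}, {(i + 1, j), (i + 1, j + 1)}}"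
| "edges (Up (i, j)) =
     {{(i, j), (i, j + 1)}, {(i, j + 1), (i + 1, j + 1)}, {(i, j), (i + 1, j + 1)}}"
| "edges (Down (i, j)) =
     {{(i, j), (i + 1, j)}, {(i + 1, j), (i + 1, j + 1)}, {(i, j), (i + 1, j + 1)}}"

definition share_edge :: "piece \<Rightarrow> piece \<Rightarrow> bool" where
  "share_edge r s \<longleftrightarrow> r \<noteq> s \<and> edges r \<inter> edges s \<noteq> {}"

text \<open>
  The lattice diagonal \<open>y - x = c\<close> is identified by its offset \<open>c\<close>; consecutive lattice diagonals
  are at distance \<open>\<surd>2/2\<close>, so in this unit the distance of two of them is the difference of their
  offsets. A diagonal passes through the unit squares whose lower left corner lies on it.
  Everything is determined up to a translation, which is fixed by putting the vertex \<open>A\<close> at the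
  origin; thus \<open>\<ell>\<close> has offset 0. The distances \<open>d\<^sub>1, \<dots>, d\<^sub>k\<close> are the entries of the list \<open>ds\<close>.
\<close>

definition offset :: "point \<Rightarrow> int" where
  "offset p = snd p - fst p"

definition lower_offset :: "nat list \<Rightarrow> int" where
  "lower_offset ds = - int (sum_list ds)"

definition drawn :: "nat list \<Rightarrow> int set" where
  "drawn ds = {- int (sum_list (take i ds)) | i. 1 \<le> i \<and> i < length ds}"

definition fundamental :: "nat list \<Rightarrow> piece set" where
  "fundamental ds = {Square p | p. offset p \<notin> drawn ds}
     \<union> {Up p | p. offset p \<in> drawn ds} \<union> {Down p | p. offset p \<in> drawn ds}"


section \<open>The colouring\<close>

text \<open>A colouring is represented by its set of black fundamental regions.\<close>

definition is_colouring :: "nat list \<Rightarrow> piece set \<Rightarrow> bool" where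
  "is_colouring ds Bl \<longleftrightarrow> Bl \<subseteq> fundamental ds
     \<and> (\<forall>r\<in>fundamental ds. \<forall>s\<in>fundamental ds. share_edge r s \<longrightarrow> (r \<in> Bl \<longleftrightarrow> s \<notin> Bl))
     \<and> (\<forall>p. offset p = 0 \<longrightarrow> Square p \<notin> Bl)"

definition black :: "nat list \<Rightarrow> piece set" where
  "black ds = (THE Bl. is_colouring ds Bl)"


section \<open>The boundary of the region\<close>

text \<open>
  \<open>ne_step ds p q\<close>: the step from \<open>p\<close> to \<open>q\<close> is a unit step south or east, and the fundamental region
  bordering it on its southwestern side is black. This is the side of the region that is being
  constructed: it lies to the left of its northeastern boundary as drawn on the page (although to
  the right of a traveller going from \<open>A\<close> to \<open>B\<close>). For \<open>k = 1\<close> one obtains in this way the Aztec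
  diamond of order \<open>a\<close>; with black regions on the northeastern side, the black cells would be
  outnumbered by the white ones.
\<close>

definition ne_step :: "nat list \<Rightarrow> point \<Rightarrow> point \<Rightarrow> bool" where
  "ne_step ds p q \<longleftrightarrow>
     q = p + (0, -1) \<and> (\<exists>r\<in>black ds. corner r = p + (-1, -1) \<and> {p, q} \<in> edges r)
   \<or> q = p + (1, 0) \<and> (\<exists>r\<in>black ds. corner r = p + (0, -1) \<and> {p, q} \<in> edges r)"

definition is_ne_boundary :: "nat list \<Rightarrow> point list \<Rightarrow> bool" where
  "is_ne_boundary ds P \<longleftrightarrow> P \<noteq> [] \<and> hd P = (0, 0) \<and> successively (ne_step ds) P
     \<and> offset (last P) = lower_offset ds
     \<and> (\<forall>p\<in>set (butlast P). offset p \<noteq> lower_offset ds)"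

definition ne_boundary :: "nat list \<Rightarrow> point list" where
  "ne_boundary ds = (THE P. is_ne_boundary ds P)"

definition vertex_A :: point where
  "vertex_A = (0, 0)"

definition vertex_B :: "nat list \<Rightarrow> point" where
  "vertex_B ds = last (ne_boundary ds)"

definition vertex_D :: "nat \<Rightarrow> point" where
  "vertex_D a = vertex_A - (int a, int a)"

text \<open>The reflection in the perpendicular bisector \<open>x + y = -a\<close> of \<open>AD\<close>.\<close>

definition reflect :: "nat \<Rightarrow> point \<Rightarrow> point" where
  "reflect a p = (- int a - snd p, - int a - fst p)"

definition sw_boundary :: "nat \<Rightarrow> nat list \<Rightarrow> point list" where
  "sw_boundary a ds = map (reflect a) (rev (ne_boundary ds))"

definition vertex_C :: "nat \<Rightarrow> nat list \<Rightarrow> point" where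
  "vertex_C a ds = reflect a (vertex_B ds)"

primrec zigzag :: "nat \<Rightarrow> point \<Rightarrow> point \<Rightarrow> point \<Rightarrow> point list" where
  "zigzag 0 u v p = [p]"
| "zigzag (Suc n) u v p = p # (p + u) # zigzag n u v (p + u + v)"

text \<open>
  Going northeast from \<open>D\<close>, the squares passed through by \<open>\<ell>\<close> are on the right if the path starts
  with a step north. Going southwest from \<open>B\<close>, those passed through by \<open>\<ell>'\<close> are on the right if it
  starts with a step south. So both rows of squares belong to the region.
\<close>

definition top_zigzag :: "nat \<Rightarrow> point list" where
  "top_zigzag a = zigzag a (0, 1) (1, 0) (vertex_D a)"

definition bottom_zigzag :: "nat \<Rightarrow> nat list \<Rightarrow> point list" where
  "bottom_zigzag a ds =
     zigzag (nat (fst (vertex_B ds) - fst (vertex_C a ds))) (0, -1) (-1, 0) (vertex_B ds)"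

definition path_edges :: "point list \<Rightarrow> edge set" where
  "path_edges P = {{P ! i, P ! Suc i} | i. Suc i < length P}"

definition boundary_edges :: "nat \<Rightarrow> nat list \<Rightarrow> edge set" where
  "boundary_edges a ds = path_edges (top_zigzag a) \<union> path_edges (ne_boundary ds)
     \<union> path_edges (bottom_zigzag a ds) \<union> path_edges (sw_boundary a ds)"


section \<open>Generalized Douglas regions\<close>

definition crossing :: "nat \<Rightarrow> nat list \<Rightarrow> piece \<Rightarrow> piece \<Rightarrow> bool" where
  "crossing a ds r s \<longleftrightarrow> r \<in> fundamental ds \<and> s \<in> fundamental ds \<and> r \<noteq> s
     \<and> (edges r \<inter> edges s) - boundary_edges a ds \<noteq> {}"

text \<open>
  The fundamental regions enclosed by the boundary are those from which only finitely many others
  can be reached without crossing the boundary, that is, those in a bounded component of its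
  complement.
\<close>

definition douglas_region :: "nat \<Rightarrow> nat list \<Rightarrow> piece set" where
  "douglas_region a ds = {r \<in> fundamental ds. finite {s. (crossing a ds)\<^sup>*\<^sup>* r s}}"

text \<open>The standing assumptions of the construction.\<close>

definition douglas_admissible :: "nat \<Rightarrow> nat list \<Rightarrow> bool" where
  "douglas_admissible a ds \<longleftrightarrow>
     (\<forall>p. offset p = lower_offset ds \<longrightarrow> Square p \<notin> black ds)
   \<and> set (ne_boundary ds) \<inter> set (sw_boundary a ds) = {}"

definition real_point :: "point \<Rightarrow> real \<times> real" where
  "real_point p = (real_of_int (fst p), real_of_int (snd p))"

definition douglas_width :: "nat \<Rightarrow> nat list \<Rightarrow> real" where
  "douglas_width a ds = dist (real_point (vertex_B ds)) (real_point (vertex_C a ds)) / sqrt 2"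

definition regular_cells :: "nat \<Rightarrow> nat list \<Rightarrow> piece set" where
  "regular_cells a ds =
     {r \<in> douglas_region a ds. r \<in> black ds \<and> (\<exists>p. r = Square p \<or> r = Up p)}"


section \<open>Tilings\<close>

definition is_tile :: "piece set \<Rightarrow> bool" where
  "is_tile t \<longleftrightarrow> (\<exists>r s. t = {r, s} \<and> share_edge r s)"

definition tilings :: "piece set \<Rightarrow> piece set set set" where
  "tilings R = {T. partition_on R T \<and> (\<forall>t\<in>T. is_tile t)}"

definition num_tilings :: "piece set \<Rightarrow> nat" where
  "num_tilings R = card (tilings R)"


section \<open>Well-definedness of the colouring and of the northeastern boundary\<close>

definition upper_piece :: "nat list \<Rightarrow> point \<Rightarrow> piece" where
  "upper_piece ds p = (if offset p \<in> drawn ds then Up p else Square p)"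

definition lower_piece :: "nat list \<Rightarrow> point \<Rightarrow> piece" where
  "lower_piece ds p = (if offset p \<in> drawn ds then Down p else Square p)"

lemma piece_in_fundamental:
  "upper_piece ds p \<in> fundamental ds" "lower_piece ds p \<in> fundamental ds"
  by (cases p; auto simp: upper_piece_def lower_piece_def fundamental_def)+

lemma fundamental_cases:
  assumes "r \<in> fundamental ds"
  shows "r = upper_piece ds (corner r) \<or> r = lower_piece ds (corner r)"
  using assms by (auto simp: upper_piece_def lower_piece_def fundamental_def)

lemma share_edge_vertical:
  "share_edge (lower_piece ds (i, j + 1)) (upper_piece ds (i, j))"
  by (auto simp: share_edge_def lower_piece_def upper_piece_def)

lemma share_edge_horizontal:
  "share_edge (lower_piece ds (i, j)) (upper_piece ds (i + 1, j))"
  by (auto simp: share_edge_def lower_piece_def upper_piece_def add.commute)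

lemma share_edge_same_square: "share_edge (Up p) (Down p)"
  by (cases p) (auto simp: share_edge_def)

lemma finite_drawn: "finite (drawn ds)"
proof -
  have "drawn ds \<subseteq> (\<lambda>i. - int (sum_list (take i ds))) ` {..<length ds}"
    by (auto simp: drawn_def)
  thus ?thesis by (rule finite_subset) simp
qed

lemma drawn_neg:
  assumes "\<forall>d\<in>set ds. 0 < d" "c \<in> drawn ds"
  shows "lower_offset ds < c" "c < 0"
proof -
  obtain i where i: "1 \<le> i" "i < length ds" "c = - int (sum_list (take i ds))"
    using assms(2) by (auto simp: drawn_def)
  have pos: "0 < sum_list xs" if "xs \<noteq> []" "\<forall>d\<in>set xs. 0 < d" for xs :: "nat list"
    using that by (cases xs) auto
  have "0 < sum_list (take i ds)"
    using i assms(1) by (intro pos) (auto dest: in_set_takeD)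
  moreover have "0 < sum_list (drop i ds)"
    using i assms(1) by (intro pos) (auto dest: in_set_dropD)
  moreover have "sum_list ds = sum_list (take i ds) + sum_list (drop i ds)"
    by (metis append_take_drop_id sum_list_append)
  ultimately show "lower_offset ds < c" "c < 0"
    using i by (auto simp: lower_offset_def)
qed

definition depth :: "nat list \<Rightarrow> int \<Rightarrow> int" where
  "depth ds c = int (card {e \<in> drawn ds. c < e}) - c"

lemma depth_step:
  "depth ds (c - 1) = depth ds c + 1 + (if c \<in> drawn ds then 1 else 0)"
proof -
  have "{e \<in> drawn ds. c - 1 < e} = {e \<in> drawn ds. c < e} \<union> (if c \<in> drawn ds then {c} else {})"
    by (auto simp: less_le)
  moreover have "finite {e \<in> drawn ds. c < e}"
    using finite_drawn by simp
  ultimately show ?thesis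
    by (simp add: depth_def card_insert_if)
qed

fun piece_depth :: "nat list \<Rightarrow> piece \<Rightarrow> int" where
  "piece_depth ds (Square p) = depth ds (offset p)"
| "piece_depth ds (Up p) = depth ds (offset p)"
| "piece_depth ds (Down p) = depth ds (offset p) + 1"

lemma share_edge_depth:
  assumes "r \<in> fundamental ds" "s \<in> fundamental ds" "share_edge r s"
  shows "odd (piece_depth ds r) \<longleftrightarrow> even (piece_depth ds s)"
proof -
  obtain i j where ij: "corner r = (i, j)" by (cases "corner r")
  obtain i' j' where ij': "corner s = (i', j')" by (cases "corner s")
  have st: "depth ds (j - i - 1) = depth ds (j - i) + 1 + (if j - i \<in> drawn ds then 1 else 0)"
    for j i by (rule depth_step)
  have e1: "j - (i + 1) = j - i - 1" "j + 1 - i = (j - i) + 1" for i j :: int by auto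
  have st2: "depth ds (j - i + 1) = depth ds (j - i) - 1 - (if j + 1 - i \<in> drawn ds then 1 else 0)"
    for j i using depth_step[of ds "j + 1 - i"] by (simp add: algebra_simps)
  show ?thesis
    using assms ij ij'
    by (cases r; cases s)
      (auto simp: share_edge_def fundamental_def offset_def doubleton_eq_iff e1 st st2)
qed

lemma is_colouring_depth:
  assumes "\<forall>d\<in>set ds. 0 < d"
  shows "is_colouring ds {r \<in> fundamental ds. odd (piece_depth ds r)}"
proof -
  have "{e \<in> drawn ds. 0 < e} = {}"
    using drawn_neg[OF assms] by force
  hence "depth ds 0 = 0" unfolding depth_def by (simp only: card.empty)
  thus ?thesis
    unfolding is_colouring_def using share_edge_depth by auto
qed

lemma colouring_unique:
  assumes pos: "\<forall>d\<in>set ds. 0 < d" and X: "is_colouring ds X" and Y: "is_colouring ds Y"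
  shows "X = Y"
proof -
  let ?ag = "\<lambda>r. r \<in> X \<longleftrightarrow> r \<in> Y"
  have flip: "?ag r \<longleftrightarrow> ?ag s"
    if "r \<in> fundamental ds" "s \<in> fundamental ds" "share_edge r s" for r s
    using that X Y unfolding is_colouring_def by blast
  have same: "?ag (upper_piece ds p) \<longleftrightarrow> ?ag (lower_piece ds p)" for p
  proof (cases "offset p \<in> drawn ds")
    case True
    thus ?thesis
      using flip[of "Up p" "Down p"] share_edge_same_square[of p]
        piece_in_fundamental[of ds p] by (auto simp: upper_piece_def lower_piece_def)
  qed (auto simp: upper_piece_def lower_piece_def)
  have vert: "?ag (lower_piece ds (i, j + 1)) \<longleftrightarrow> ?ag (upper_piece ds (i, j))" for i j
    by (intro flip piece_in_fundamental share_edge_vertical)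
  have all: "?ag (upper_piece ds (i, i + c))" for i c
  proof (induction c rule: int_induct[where k = 0])
    case base
    have "0 \<notin> drawn ds" using drawn_neg[OF pos, of 0] by auto
    thus ?case
      using X Y by (auto simp: upper_piece_def offset_def is_colouring_def)
  next
    case (step1 c)
    thus ?case using vert[of i "i + c"] same by (simp add: add.assoc)
  next
    case (step2 c)
    thus ?case using vert[of i "i + (c - 1)"] same by (simp add: add.assoc)
  qed
  have "?ag r" if "r \<in> fundamental ds" for r
  proof -
    obtain i j where ij: "corner r = (i, j)" by (cases "corner r")
    have "?ag (upper_piece ds (i, j))" using all[of i "j - i"] by simp
    thus ?thesis using fundamental_cases[OF that] same[of "(i, j)"] ij by auto
  qed
  thus ?thesis using X Y unfolding is_colouring_def by blast
qed

lemma black_eq: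
  assumes "\<forall>d\<in>set ds. 0 < d"
  shows "black ds = {r \<in> fundamental ds. odd (piece_depth ds r)}"
  unfolding black_def
  using is_colouring_depth[OF assms] colouring_unique[OF assms]
  by (intro the_equality) auto

lemma is_colouring_black:
  assumes "\<forall>d\<in>set ds. 0 < d"
  shows "is_colouring ds (black ds)"
  using is_colouring_depth[OF assms] black_eq[OF assms] by simp

lemma ne_step_iff:
  assumes pos: "\<forall>d\<in>set ds. 0 < d"
  shows "ne_step ds (x, y) q \<longleftrightarrow>
    q = (if lower_piece ds (x - 1, y - 1) \<in> black ds then (x, y - 1) else (x + 1, y))"
proof -
  have sub: "black ds \<subseteq> fundamental ds"
    using is_colouring_black[OF pos] by (simp add: is_colouring_def)
  have south: "(\<exists>r\<in>black ds. corner r = (x - 1, y - 1) \<and> {(x, y), (x, y - 1)} \<in> edges r)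
      \<longleftrightarrow> lower_piece ds (x - 1, y - 1) \<in> black ds" (is "?L \<longleftrightarrow> ?R")
  proof
    assume ?L
    then obtain r where r: "r \<in> black ds" "corner r = (x - 1, y - 1)"
        "{(x, y), (x, y - 1)} \<in> edges r" by blast
    have "r \<in> fundamental ds" using r sub by blast
    hence "r = lower_piece ds (x - 1, y - 1)"
      using r(2,3) by (cases r) (auto simp: lower_piece_def fundamental_def doubleton_eq_iff)
    thus ?R using r by simp
  next
    assume ?R
    thus ?L by (intro bexI[of _ "lower_piece ds (x - 1, y - 1)"])
        (auto simp: lower_piece_def doubleton_eq_iff)
  qed
  have east: "(\<exists>r\<in>black ds. corner r = (x, y - 1) \<and> {(x, y), (x + 1, y)} \<in> edges r)
      \<longleftrightarrow> upper_piece ds (x, y - 1) \<in> black ds" (is "?L \<longleftrightarrow> ?R")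
  proof
    assume ?L
    then obtain r where r: "r \<in> black ds" "corner r = (x, y - 1)"
        "{(x, y), (x + 1, y)} \<in> edges r" by blast
    have "r \<in> fundamental ds" using r sub by blast
    hence "r = upper_piece ds (x, y - 1)"
      using r(2,3) by (cases r) (auto simp: upper_piece_def fundamental_def doubleton_eq_iff)
    thus ?R using r by simp
  next
    assume ?R
    thus ?L by (intro bexI[of _ "upper_piece ds (x, y - 1)"])
        (auto simp: upper_piece_def doubleton_eq_iff)
  qed
  have "share_edge (lower_piece ds (x - 1, y - 1)) (upper_piece ds (x, y - 1))"
    using share_edge_horizontal[of ds "x - 1" "y - 1"] by simp
  hence opp: "lower_piece ds (x - 1, y - 1) \<in> black ds
      \<longleftrightarrow> upper_piece ds (x, y - 1) \<notin> black ds"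
    using is_colouring_black[OF pos] piece_in_fundamental unfolding is_colouring_def by blast
  show ?thesis
    using south east opp by (auto simp: ne_step_def)
qed

primrec ne_point :: "nat list \<Rightarrow> nat \<Rightarrow> point" where
  "ne_point ds 0 = (0, 0)"
| "ne_point ds (Suc m) = (case ne_point ds m of (x, y) \<Rightarrow>
     if lower_piece ds (x - 1, y - 1) \<in> black ds then (x, y - 1) else (x + 1, y))"

lemma offset_ne_point: "offset (ne_point ds m) = - int m"
  by (induction m) (auto simp: offset_def split: prod.split)

lemma ne_step_ne_point:
  assumes "\<forall>d\<in>set ds. 0 < d"
  shows "ne_step ds (ne_point ds m) q \<longleftrightarrow> q = ne_point ds (Suc m)"
  by (cases "ne_point ds m") (simp add: ne_step_iff[OF assms])

lemma is_ne_boundary_iff: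
  assumes pos: "\<forall>d\<in>set ds. 0 < d"
  shows "is_ne_boundary ds P \<longleftrightarrow> P = map (ne_point ds) [0..<Suc (sum_list ds)]"
proof
  assume P: "is_ne_boundary ds P"
  have nth: "P ! i = ne_point ds i" if "i < length P" for i
    using that
  proof (induction i)
    case 0
    thus ?case using P by (simp add: is_ne_boundary_def hd_conv_nth)
  next
    case (Suc i)
    have "ne_step ds (P ! i) (P ! Suc i)"
      using P Suc.prems by (auto simp: is_ne_boundary_def successively_conv_nth)
    thus ?case using Suc by (simp add: ne_step_ne_point[OF pos] del: ne_point.simps)
  qed
  have ne: "P \<noteq> []" using P by (simp add: is_ne_boundary_def)
  have "offset (P ! (length P - 1)) = lower_offset ds"
    using P last_conv_nth[OF ne] by (simp add: is_ne_boundary_def)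
  hence "length P - 1 = sum_list ds"
    using nth[of "length P - 1"] ne by (simp add: offset_ne_point lower_offset_def)
  hence len: "length P = Suc (sum_list ds)" using ne by (cases P) auto
  show "P = map (ne_point ds) [0..<Suc (sum_list ds)]"
    by (rule nth_equalityI) (use len nth in \<open>auto simp del: upt_Suc\<close>)
next
  assume P: "P = map (ne_point ds) [0..<Suc (sum_list ds)]"
  have "successively (ne_step ds) P"
    unfolding P successively_conv_nth
    by (auto simp: ne_step_ne_point[OF pos] simp del: upt_Suc ne_point.simps)
  moreover have "hd P = (0, 0)"
    unfolding P by (simp add: hd_map del: upt_Suc)
  moreover have "butlast P = map (ne_point ds) [0..<sum_list ds]" by (simp add: P)
  ultimately show "is_ne_boundary ds P"
    by (auto simp: is_ne_boundary_def P offset_ne_point lower_offset_def)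
qed

lemma ne_boundary_eq:
  assumes "\<forall>d\<in>set ds. 0 < d"
  shows "ne_boundary ds = map (ne_point ds) [0..<Suc (sum_list ds)]"
  unfolding ne_boundary_def is_ne_boundary_iff[OF assms] by simp

lemma is_ne_boundary_ne_boundary:
  assumes "\<forall>d\<in>set ds. 0 < d"
  shows "is_ne_boundary ds (ne_boundary ds)"
  using is_ne_boundary_iff[OF assms] ne_boundary_eq[OF assms] by simp

end

theory Submission
  imports Defs
begin

text \<open>
  Record a tiling row by row (a row consists of the squares on one lattice diagonal) by its
  particles: the white cells that are matched downwards or the black cells that are matched upwards.
  Crossing a drawn-in diagonal does not change the configuration, so the number of tilings depends
  only on the word of east and south steps of the northeastern boundary. In an east step every particle stays or moves one place to the right in a row that is
  longer by one; a south step is the transpose of an east step acting on the holes. The two transfer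
  operators satisfy ``east, then south = 2 times south, then east'', and the word that begins with
  all its south steps has exactly one route from the full to the empty row. As \<open>D\<close> and \<open>B\<close> lie at the
  same height there are \<open>a\<close> south steps, so the number of tilings is 2 to the number of pairs of an
  east step and a later south step. An east step leads to a black row whose length is the number of
  later south steps plus the number of east steps made so far; summing over the east steps
  identifies this exponent with \<open>C - w(w+1)/2\<close>.
\<close>

section \<open>Particle configurations\<close>

declare sum_of_bool_eq [simp del] sum_mult_of_bool_eq [simp del] sum_of_bool_mult_eq [simp del]

definition blists :: "nat \<Rightarrow> bool list set" where
  "blists n = {ys. length ys = n}"

lemma finite_blists [simp]: "finite (blists n)"
  using finite_lists_length_eq[of "UNIV :: bool set" n] by (simp add: blists_def)

lemma blists_0 [simp]: "blists 0 = {[]}"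
  by (auto simp: blists_def)

lemma blists_Suc: "blists (Suc n) = (Cons True) ` blists n \<union> (Cons False) ` blists n"
  by (auto simp: blists_def length_Suc_conv image_iff)

lemma sum_blists_Suc:
  "(\<Sum>Y\<in>blists (Suc n). f Y) = (\<Sum>Y\<in>blists n. f (True # Y) + f (False # Y))"
  for f :: "bool list \<Rightarrow> 'a :: comm_monoid_add"
  unfolding blists_Suc sum.distrib
  by (subst sum.union_disjoint) (auto simp: sum.reindex inj_on_def)

lemma sum_blists_map_Not:
  "(\<Sum>Y\<in>blists n. f (map Not Y)) = (\<Sum>Y\<in>blists n. f Y)"
  for f :: "bool list \<Rightarrow> 'a :: comm_monoid_add"
  by (rule sum.reindex_bij_witness[of _ "map Not" "map Not"]) (auto simp: blists_def comp_def)

text \<open>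
  \<open>slides l c xs ys\<close>: the particles of \<open>xs\<close>, each staying or moving one place to the right, can end up
  in \<open>ys\<close>. The flag \<open>c\<close> says whether a further particle arrives at the first place from its left. If
  \<open>l\<close> holds, \<open>ys\<close> is longer by one than \<open>xs\<close>; otherwise the last particle must not leave the row.
\<close>

fun slides :: "bool \<Rightarrow> bool \<Rightarrow> bool list \<Rightarrow> bool list \<Rightarrow> bool" where
  "slides l c [] ys \<longleftrightarrow> (if l then ys = [c] else ys = [] \<and> \<not> c)"
| "slides l c (x # xs) [] \<longleftrightarrow> False"
| "slides l c (x # xs) (y # ys) \<longleftrightarrow>
     (c \<longrightarrow> y) \<and> (y \<longrightarrow> c \<or> x) \<and> slides l (x \<and> (c \<or> \<not> y)) xs ys"

lemma slides_transpose:
  "length vs = length zs \<Longrightarrow>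
   slides True c zs (v # vs) \<longleftrightarrow> (c \<longrightarrow> v) \<and> slides False (v \<and> \<not> c) vs zs"
proof (induction zs arbitrary: c v vs)
  case (Cons z zs)
  then obtain v' vs' where "vs = v' # vs'" by (cases vs) auto
  with Cons show ?case by auto
qed auto

datatype step = East | South

fun routes :: "step list \<Rightarrow> bool list \<Rightarrow> nat" where
  "routes [] X = of_bool (True \<notin> set X)"
| "routes (East # u) X =
     (\<Sum>Y\<in>blists (Suc (length X)). of_bool (slides True False X Y) * routes u Y)"
| "routes (South # u) [] = 0"
| "routes (South # u) (x # X) =
     (\<Sum>Y\<in>blists (length X).
        of_bool (slides False (\<not> x) (map Not X) (map Not Y)) * routes u Y)"

text \<open>
  In both orders of the two steps the intermediate row is scanned by a pair of automata; the flags
  \<open>c\<close> and \<open>d\<close> are their states. They make the commutation relation provable by list induction.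
\<close>

definition east_south :: "bool \<Rightarrow> bool \<Rightarrow> bool list \<Rightarrow> bool list \<Rightarrow> nat" where
  "east_south c d X Z = (\<Sum>Y\<in>blists (Suc (length X)).
     of_bool (slides True c X Y) * of_bool (slides True d (map Not Z) (map Not Y)))"

definition south_east :: "bool \<Rightarrow> bool \<Rightarrow> bool list \<Rightarrow> bool list \<Rightarrow> nat" where
  "south_east c d X Z = (\<Sum>Y\<in>blists (length X - 1).
     of_bool (slides True c (map Not Y) (map Not X)) * of_bool (slides True d Y Z))"

lemma east_south_Nil: "east_south c d [] [] = of_bool (c \<noteq> d)"
  by (auto simp: east_south_def sum_blists_Suc)

lemma east_south_Cons:
  "east_south c d (x # X) (z # Z) =
     of_bool ((\<not> d) \<and> (c \<or> x)) * east_south (x \<and> c) (\<not> z) X Z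
   + of_bool ((\<not> c) \<and> (d \<or> \<not> z)) * east_south x (\<not> z \<and> d) X Z"
  unfolding east_south_def sum_distrib_left sum.distrib[symmetric] list.size add_Suc_right add_0_right
  by (subst sum_blists_Suc, intro sum.cong) auto

lemma south_east_single: "south_east c d [x] [z] = of_bool (x \<noteq> c \<and> z = d)"
  by (auto simp: south_east_def)

lemma south_east_Cons:
  "south_east c d (x # x' # X) (z # Z) =
     of_bool ((c \<longrightarrow> \<not> x) \<and> (\<not> x \<longrightarrow> c) \<and> (d \<longrightarrow> z)) * south_east False (d \<or> \<not> z) (x' # X) Z
   + of_bool ((c \<longrightarrow> \<not> x) \<and> (d \<longrightarrow> z) \<and> (z \<longrightarrow> d)) * south_east (c \<or> x) False (x' # X) Z"
proof -
  have len: "length (x # x' # X) - 1 = Suc (length X)" "length (x' # X) - 1 = length X" by simp_all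
  show ?thesis
    unfolding south_east_def sum_distrib_left sum.distrib[symmetric] len
    by (subst sum_blists_Suc, intro sum.cong) auto
qed

lemma east_south_eq_south_east:
  assumes "length X = length Z"
  shows "east_south False False (x # X) (z # Z) = 2 * south_east False False (x # X) (z # Z)
    \<and> east_south True False (x # X) (z # Z)
        = south_east True False (x # X) (z # Z) + south_east False True (x # X) (z # Z)
    \<and> east_south False True (x # X) (z # Z)
        = south_east True False (x # X) (z # Z) + south_east False True (x # X) (z # Z)
    \<and> east_south True True (x # X) (z # Z) = 0"
  using assms
proof (induction X Z arbitrary: x z rule: list_induct2)
  case Nil
  show ?case by (cases x; cases z) (simp_all add: east_south_Cons east_south_Nil south_east_single)
next
  case (Cons x' X z' Z)
  show ?case
    unfolding east_south_Cons[of _ _ x "x' # X"] south_east_Cons[of _ _ x]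
    using Cons.IH[of x' z'] by (cases x; cases z) simp_all
qed

lemma routes_East_South: "routes (East # South # u) X = 2 * routes (South # East # u) X"
proof (cases X)
  case Nil
  have "slides True False [] Y \<Longrightarrow> routes (South # u) Y = 0" for Y by auto
  thus ?thesis using Nil by (simp add: sum_blists_Suc)
next
  case (Cons x X')
  let ?n = "length X"
  have "routes (East # South # u) X = (\<Sum>Y\<in>blists (Suc ?n). \<Sum>Z\<in>blists ?n.
      of_bool (slides True False X Y) * of_bool (slides True False (map Not Z) (map Not Y))
        * routes u Z)"
    unfolding routes.simps
  proof (intro sum.cong refl)
    fix Y assume "Y \<in> blists (Suc ?n)"
    then obtain y Y' where Y: "Y = y # Y'" "length Y' = ?n"
      by (auto simp: blists_def length_Suc_conv)
    show "of_bool (slides True False X Y) * routes (South # u) Y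
        = (\<Sum>Z\<in>blists ?n. of_bool (slides True False X Y)
            * of_bool (slides True False (map Not Z) (map Not Y)) * routes u Z)"
      unfolding Y routes.simps sum_distrib_left
      by (intro sum.cong) (auto simp: Y(2) slides_transpose blists_def)
  qed
  also have "\<dots> = (\<Sum>Z\<in>blists ?n. east_south False False X Z * routes u Z)"
    by (subst sum.swap) (simp add: east_south_def sum_distrib_right)
  also have "\<dots> = (\<Sum>Z\<in>blists ?n. 2 * (south_east False False X Z * routes u Z))"
  proof (intro sum.cong refl)
    fix Z assume "Z \<in> blists ?n"
    then obtain z Z' where "Z = z # Z'" "length X' = length Z'"
      using Cons by (cases Z) (auto simp: blists_def)
    thus "east_south False False X Z * routes u Z = 2 * (south_east False False X Z * routes u Z)"
      using east_south_eq_south_east[of X' Z' x z] Cons by simp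
  qed
  also have "\<dots> = 2 * (\<Sum>Y\<in>blists (length X'). \<Sum>Z\<in>blists ?n.
      of_bool (slides True False (map Not Y) (map Not X)) * (of_bool (slides True False Y Z)
        * routes u Z))"
    by (subst sum.swap) (simp add: south_east_def sum_distrib_right sum_distrib_left Cons mult.assoc)
  also have "(\<Sum>Y\<in>blists (length X'). \<Sum>Z\<in>blists ?n.
      of_bool (slides True False (map Not Y) (map Not X)) * (of_bool (slides True False Y Z)
        * routes u Z)) = routes (South # East # u) X"
    unfolding Cons routes.simps sum_distrib_left
    by (intro sum.cong) (auto simp: blists_def slides_transpose)
  finally show ?thesis .
qed

lemma routes_move_East:
  "routes (East # u) X = 2 ^ count_list u South * routes (u @ [East]) X"
proof (induction u arbitrary: X)
  case (Cons s u)
  show ?case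
  proof (cases s)
    case East
    have "routes (East # East # u) X
        = (\<Sum>Y\<in>blists (Suc (length X)). of_bool (slides True False X Y) * routes (East # u) Y)"
      by simp
    thus ?thesis unfolding Cons.IH East by (simp add: sum_distrib_left mult_ac)
  next
    case South
    have "routes (South # East # u) X = 2 ^ count_list u South * routes (South # u @ [East]) X"
    proof (cases X)
      case X: (Cons x X')
      have "routes (South # East # u) X = (\<Sum>Y\<in>blists (length X').
          of_bool (slides False (\<not> x) (map Not X') (map Not Y)) * routes (East # u) Y)"
        by (simp add: X)
      thus ?thesis unfolding Cons.IH by (simp add: X sum_distrib_left mult_ac)
    qed simp
    thus ?thesis using routes_East_South[of u X] South by simp
  qed
qed simp

lemma slides_to_empty:
  "True \<notin> set Y \<Longrightarrow> length Y = Suc (length X) \<Longrightarrow>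
   slides True c X Y \<longleftrightarrow> \<not> c \<and> True \<notin> set X"
proof (induction X arbitrary: c Y)
  case Nil
  thus ?case by (cases Y) auto
next
  case (Cons x X)
  thus ?case by (cases Y) auto
qed

lemma routes_single_East: "routes [East] X = routes [] X"
proof -
  let ?E = "replicate (Suc (length X)) False"
  have "routes [East] X = (\<Sum>Y\<in>blists (Suc (length X)). if Y = ?E then of_bool (True \<notin> set X) else 0)"
    unfolding routes.simps
  proof (intro sum.cong refl)
    fix Y assume Y: "Y \<in> blists (Suc (length X))"
    have "True \<notin> set Y \<longleftrightarrow> Y = ?E"
    proof
      assume "True \<notin> set Y"
      hence "\<forall>y\<in>set Y. y = False" by auto
      from replicate_length_same[OF this] show "Y = ?E" using Y by (simp add: blists_def)
    qed (simp del: replicate_Suc)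
    thus "of_bool (slides True False X Y) * of_bool (True \<notin> set Y)
        = (if Y = ?E then of_bool (True \<notin> set X) else (0::nat))"
      using slides_to_empty[of Y X False] Y by (auto simp: blists_def)
  qed
  also have "\<dots> = of_bool (True \<notin> set X)"
    by (subst sum.delta[OF finite_blists]) (simp add: blists_def)
  finally show ?thesis by simp
qed

lemma routes_append_East: "routes (u @ [East]) X = routes u X"
proof (induction u X rule: routes.induct)
  case (1 X)
  thus ?case using routes_single_East by simp
qed simp_all

lemma slides_full:
  "length Y = n \<Longrightarrow> slides False False (replicate n False) (map Not Y) \<longleftrightarrow> Y = replicate n True"
proof (induction n arbitrary: Y)
  case (Suc n)
  thus ?case by (cases Y) auto
qed simp

lemma routes_South_full: "routes (South # u) (replicate (Suc n) True) = routes u (replicate n True)"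
proof -
  have "routes (South # u) (replicate (Suc n) True)
      = (\<Sum>Y\<in>blists n. if Y = replicate n True then routes u (replicate n True) else 0)"
    by (auto intro!: sum.cong simp: slides_full blists_def)
  also have "\<dots> = routes u (replicate n True)"
    by (subst sum.delta[OF finite_blists]) (simp add: blists_def)
  finally show ?thesis .
qed

fun inversions :: "step list \<Rightarrow> nat" where
  "inversions [] = 0"
| "inversions (East # u) = count_list u South + inversions u"
| "inversions (South # u) = inversions u"

lemma routes_full: "routes u (replicate (count_list u South) True) = 2 ^ inversions u"
proof (induction u rule: inversions.induct)
  case (2 u)
  show ?case
    using 2 routes_move_East[of u] by (simp add: routes_append_East power_add del: routes.simps)
next
  case (3 u)
  show ?case
    using 3 routes_South_full[of u "count_list u South"] by (simp del: routes.simps replicate_Suc)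
qed simp

text \<open>The argument \<open>m\<close> is the length of the current row.\<close>

fun black_count :: "int \<Rightarrow> step list \<Rightarrow> int" where
  "black_count m [] = 0"
| "black_count m (East # u) = (m + 1) + black_count (m + 1) u"
| "black_count m (South # u) = black_count (m - 1) u"

lemma black_count_eq:
  "2 * black_count (h + int (count_list u South)) u = 2 * int (inversions u)
     + int (count_list u East) * (2 * h + int (count_list u East) + 1)"
proof (induction u arbitrary: h rule: inversions.induct)
  case (2 u)
  show ?case using 2[of "h + 1"] by (simp add: algebra_simps)
next
  case (3 u)
  show ?case using 3[of h] by (simp add: algebra_simps)
qed simp

section \<open>Counting tilings\<close>

lemma finite_tilings: "finite R \<Longrightarrow> finite (tilings R)"
  using finitely_many_partition_on[of R] by (auto simp: tilings_def)

lemma share_edge_sym: "share_edge r s \<longleftrightarrow> share_edge s r"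
  by (auto simp: share_edge_def)

lemma tilings_insert:
  assumes "T \<in> tilings (R - {r, s})" "r \<in> R" "s \<in> R" "share_edge r s"
  shows "insert {r, s} T \<in> tilings R"
  using assms by (auto simp: tilings_def partition_on_def disjoint_def is_tile_def)

lemma tilings_remove:
  assumes "T \<in> tilings R" "{r, s} \<in> T"
  shows "T - {{r, s}} \<in> tilings (R - {r, s})"
proof -
  have U: "\<Union>T = R" and tile: "\<forall>t\<in>T. is_tile t" and ne: "{} \<notin> T"
    and disj: "\<And>t. t \<in> T \<Longrightarrow> t \<noteq> {r, s} \<Longrightarrow> t \<inter> {r, s} = {}" and disjT: "disjoint T"
    using assms by (auto simp: tilings_def partition_on_def disjoint_def)
  have "\<Union>(T - {{r, s}}) = R - {r, s}"
  proof (intro equalityI subsetI)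
    fix q assume "q \<in> \<Union>(T - {{r, s}})"
    thus "q \<in> R - {r, s}" using U disj by blast
  qed (use U in blast)
  moreover have "disjoint (T - {{r, s}})" using disjT by (auto simp: disjoint_def)
  ultimately show ?thesis using tile ne by (auto simp: tilings_def partition_on_def)
qed

lemma tilings_expand:
  assumes "r \<in> R"
  shows "tilings R
    = (\<Union>s\<in>{s \<in> R. share_edge r s}. insert {r, s} ` tilings (R - {r, s}))"
proof (intro equalityI subsetI)
  fix T assume T: "T \<in> tilings R"
  then obtain t where t: "t \<in> T" "r \<in> t" "t \<subseteq> R" "is_tile t"
    using assms by (auto simp: tilings_def partition_on_def)
  then obtain s where s: "t = {r, s}" "share_edge r s"
    by (auto simp: is_tile_def share_edge_sym)
  have "T = insert {r, s} (T - {{r, s}})" using t s by auto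
  thus "T \<in> (\<Union>s\<in>{s \<in> R. share_edge r s}. insert {r, s} ` tilings (R - {r, s}))"
    using tilings_remove[OF T, of r s] t s by blast
next
  fix T assume "T \<in> (\<Union>s\<in>{s \<in> R. share_edge r s}. insert {r, s} ` tilings (R - {r, s}))"
  thus "T \<in> tilings R" using tilings_insert assms by auto
qed

lemma num_tilings_expand:
  assumes "finite R" "r \<in> R"
  shows "num_tilings R = (\<Sum>s\<in>{s \<in> R. share_edge r s}. num_tilings (R - {r, s}))"
proof -
  have notin: "t \<subseteq> R'" if "T \<in> tilings R'" "t \<in> T" for T R' t
    using that by (auto simp: tilings_def partition_on_def)
  have inj: "inj_on (insert {r, s}) (tilings (R - {r, s}))" for s
  proof (rule inj_onI)
    fix T T' assume *: "T \<in> tilings (R - {r, s})" "T' \<in> tilings (R - {r, s})"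
      "insert {r, s} T = insert {r, s} T'"
    have "{r, s} \<notin> T" "{r, s} \<notin> T'" using notin[OF *(1)] notin[OF *(2)] by auto
    thus "T = T'" using *(3) by (simp add: insert_ident)
  qed
  have disj: "insert {r, s} ` tilings (R - {r, s}) \<inter> insert {r, s'} ` tilings (R - {r, s'}) = {}"
    if "s \<noteq> s'" for s s'
  proof (rule ccontr)
    assume "\<not> ?thesis"
    then obtain T T' where *: "T \<in> tilings (R - {r, s})" "T' \<in> tilings (R - {r, s'})"
      "insert {r, s} T = insert {r, s'} T'" by auto
    have "{r, s'} \<noteq> {r, s}" using that by (auto simp: doubleton_eq_iff)
    moreover have "{r, s'} \<in> insert {r, s} T" unfolding *(3) by simp
    ultimately have "{r, s'} \<in> T" by (metis insertE)
    thus False using notin[OF *(1)] by auto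
  qed
  show ?thesis
    unfolding num_tilings_def tilings_expand[OF assms(2)]
    by (subst card_UN_disjoint)
      (use assms(1) inj disj in \<open>auto simp: finite_tilings card_image\<close>)
qed

lemma num_tilings_empty: "num_tilings {} = 1"
proof -
  have "tilings {} = {{}}" by (auto simp: tilings_def partition_on_def)
  thus ?thesis by (simp add: num_tilings_def)
qed

lemma num_tilings_independent:
  assumes "finite R" "\<And>r s. r \<in> R \<Longrightarrow> s \<in> R \<Longrightarrow> \<not> share_edge r s"
  shows "num_tilings R = of_bool (R = {})"
proof (cases "R = {}")
  case False
  then obtain r where r: "r \<in> R" by blast
  hence "{s \<in> R. share_edge r s} = {}" using assms(2) by auto
  from num_tilings_expand[OF assms(1) r, unfolded this] show ?thesis using False by simp
qed (simp add: num_tilings_empty)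

lemma num_tilings_forced:
  assumes "finite I" "finite D"
    and inj: "inj_on f I" "inj_on g I"
    and disj: "f ` I \<inter> g ` I = {}" "(f ` I \<union> g ` I) \<inter> D = {}"
    and adj: "\<And>i s. i \<in> I \<Longrightarrow> s \<in> f ` I \<union> g ` I \<union> D \<Longrightarrow> share_edge (f i) s \<longleftrightarrow> s = g i"
  shows "num_tilings (f ` I \<union> g ` I \<union> D) = num_tilings D"
  using assms(1) inj disj adj
proof (induction I rule: finite_induct)
  case (insert i I)
  let ?R = "f ` insert i I \<union> g ` insert i I \<union> D"
  have nb: "{s \<in> ?R. share_edge (f i) s} = {g i}"
    using insert.prems(5)[of i] by blast
  have rem: "?R - {f i, g i} = f ` I \<union> g ` I \<union> D"
    using insert.prems(1-4) insert.hyps by (auto simp: inj_on_def)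
  have "num_tilings ?R = num_tilings (?R - {f i, g i})"
    using num_tilings_expand[of ?R "f i"] insert.hyps(1) assms(2) unfolding nb by simp
  also have "\<dots> = num_tilings (f ` I \<union> g ` I \<union> D)" unfolding rem ..
  also have "\<dots> = num_tilings D"
  proof (rule insert.IH)
    show "inj_on f I" "inj_on g I" using insert.prems(1,2) by (auto simp: inj_on_def)
    show "f ` I \<inter> g ` I = {}" "(f ` I \<union> g ` I) \<inter> D = {}" using insert.prems(3,4) by auto
    show "\<And>i s. i \<in> I \<Longrightarrow> s \<in> f ` I \<union> g ` I \<union> D \<Longrightarrow> share_edge (f i) s \<longleftrightarrow> s = g i"
      using insert.prems(5) by blast
  qed
  finally show ?case .
qed simp

definition sel :: "(nat \<Rightarrow> 'a) \<Rightarrow> bool list \<Rightarrow> 'a set" where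
  "sel f xs = {f k | k. k < length xs \<and> xs ! k}"

lemma sel_Nil [simp]: "sel f [] = {}"
  by (simp add: sel_def)

lemma sel_Cons [simp]:
  "sel f (x # xs) = (if x then {f 0} else {}) \<union> sel (\<lambda>k. f (Suc k)) xs"
proof -
  have "k < length (x # xs) \<and> (x # xs) ! k
      \<longleftrightarrow> k = 0 \<and> x \<or> (\<exists>j. k = Suc j \<and> j < length xs \<and> xs ! j)" for k
    by (cases k) auto
  thus ?thesis by (auto simp: sel_def)
qed

lemma sel_subset: "sel f xs \<subseteq> f ` {..<length xs}"
  by (auto simp: sel_def)

lemma finite_sel [simp]: "finite (sel f xs)"
  by (rule finite_subset[OF sel_subset]) simp

lemma sel_replicate: "sel f (replicate n True) = f ` {..<n}"
proof -
  have "{k. k < length (replicate n True) \<and> replicate n True ! k} = {..<n}" by auto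
  thus ?thesis unfolding sel_def setcompr_eq_image by (rule arg_cong)
qed

fun avail :: "bool \<Rightarrow> nat \<Rightarrow> bool list" where
  "avail c 0 = []"
| "avail c (Suc n) = (\<not> c) # avail False n"

lemma length_avail [simp]: "length (avail c n) = n"
  by (induction n arbitrary: c) auto

lemma avail_False: "avail False n = replicate n True"
  by (induction n) auto

text \<open>
  The pieces \<open>U k\<close> must be matched to the pieces \<open>V k\<close> and \<open>V (Suc k)\<close> of
  the next row; \<open>V 0\<close> is missing if \<open>c\<close> holds, and the last \<open>V\<close> is missing unless \<open>l\<close> holds.
\<close>

lemma num_tilings_row:
  assumes "finite D" "l \<or> xs \<noteq> [] \<or> \<not> c"
    and "inj_on U {..<length xs}" "inj_on V {..length xs}"
    and "U ` {..<length xs} \<inter> (V ` {..length xs} \<union> D) = {}" "V ` {..length xs} \<inter> D = {}"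
    and "\<And>k s. k < length xs \<Longrightarrow> s \<in> U ` {..<length xs} \<union> V ` {..length xs} \<union> D
           \<Longrightarrow> share_edge (U k) s \<longleftrightarrow> s = V k \<or> s = V (Suc k)"
  shows "num_tilings (sel U xs \<union> sel V (avail c (length xs + of_bool l)) \<union> D)
    = (\<Sum>Y\<in>blists (length xs + of_bool l).
         of_bool (slides l c xs Y) * num_tilings (sel V (map Not Y) \<union> D))"
  using assms
proof (induction xs arbitrary: U V D c)
  case Nil
  thus ?case by (cases l; cases c) (simp_all add: sum_blists_Suc)
next
  case (Cons x xs)
  let ?m = "length xs"
  let ?n = "?m + of_bool l"
  let ?U = "\<lambda>k. U (Suc k)" and ?V = "\<lambda>k. V (Suc k)"
  have V0: "V 0 \<noteq> V (Suc k)" if "k \<le> ?m" for k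
    using inj_onD[OF Cons.prems(4), of 0 "Suc k"] that by auto
  have U0: "U 0 \<noteq> U (Suc k)" if "k < ?m" for k
    using inj_onD[OF Cons.prems(3), of 0 "Suc k"] that by auto
  have UV: "U i \<noteq> V j" if "i \<le> ?m" "j \<le> Suc ?m" for i j
    using Cons.prems(5) that by (fastforce simp: less_Suc_eq_le)
  have UD: "U i \<notin> D" if "i \<le> ?m" for i
    using Cons.prems(5) that by (fastforce simp: less_Suc_eq_le)
  have VD: "V i \<notin> D" if "i \<le> Suc ?m" for i
    using Cons.prems(6) that by fastforce
  have subU: "sel ?U zs \<subseteq> ?U ` {..<?m}" if "length zs = ?m" for zs
    using sel_subset[of ?U zs] that by simp
  have subV: "sel ?V zs \<subseteq> ?V ` {..?m}" if "length zs \<le> Suc ?m" for zs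
    using sel_subset[of ?V zs] that by (fastforce simp: less_Suc_eq_le)
  have subA: "sel ?V (avail c' ?n) \<subseteq> ?V ` {..?m}" for c'
    by (rule subV) (cases l; simp)
  have IH: "num_tilings (sel ?U xs \<union> sel ?V (avail c' ?n) \<union> D')
      = (\<Sum>Y\<in>blists ?n. of_bool (slides l c' xs Y) * num_tilings (sel ?V (map Not Y) \<union> D'))"
    if D': "D' = D \<or> D' = insert (V 0) D" and c': "l \<or> xs \<noteq> [] \<or> \<not> c'" for c' D'
  proof (rule Cons.IH)
    show "finite D'" using D' Cons.prems(1) by auto
    show "inj_on ?U {..<?m}" "inj_on ?V {..?m}"
      using Cons.prems(3,4) by (auto simp: inj_on_def)
    show "?U ` {..<?m} \<inter> (?V ` {..?m} \<union> D') = {}" "?V ` {..?m} \<inter> D' = {}"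
      using D' UV UD VD V0 by (auto, metis)
    fix k s assume k: "k < ?m" "s \<in> ?U ` {..<?m} \<union> ?V ` {..?m} \<union> D'"
    have "s \<in> U ` {..<length (x # xs)} \<union> V ` {..length (x # xs)} \<union> D"
      using k(2) D' by auto
    from Cons.prems(7)[OF _ this, of "Suc k"] k(1)
    show "share_edge (?U k) s \<longleftrightarrow> s = ?V k \<or> s = ?V (Suc k)" by simp
  qed (fact c')
  let ?R = "sel U (x # xs) \<union> sel V (avail c (Suc ?n)) \<union> D"
  have step: "blists (length (x # xs) + of_bool l) = blists (Suc ?n)"
    "avail c (length (x # xs) + of_bool l) = avail c (Suc ?n)" by simp_all
  have finR: "finite ?R" using Cons.prems(1) by simp
  have nb: "{s \<in> ?R. share_edge (U 0) s} = ?R \<inter> {V 0, V 1}"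
  proof -
    have "sel V (avail c (Suc ?n)) \<subseteq> V ` {..<length (avail c (Suc ?n))}" by (rule sel_subset)
    also have "\<dots> \<subseteq> V ` {..length (x # xs)}"
      by (intro image_mono) (cases l; auto)
    finally have "?R \<subseteq> U ` {..<length (x # xs)} \<union> V ` {..length (x # xs)} \<union> D"
      using sel_subset[of U "x # xs"] by blast
    moreover have "share_edge (U 0) s \<longleftrightarrow> s = V 0 \<or> s = V 1"
      if "s \<in> U ` {..<length (x # xs)} \<union> V ` {..length (x # xs)} \<union> D" for s
      using Cons.prems(7)[OF _ that, of 0] by simp
    ultimately show ?thesis by blast
  qed
  have notU: "V j \<notin> sel ?U xs" if "j \<le> Suc ?m" for j
  proof
    assume "V j \<in> sel ?U xs"
    then obtain k where "k < ?m" "V j = U (Suc k)" using subU[of xs] by auto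
    thus False using UV[of "Suc k" j] that by auto
  qed
  have V0V: "V 0 \<notin> sel ?V (avail c' ?n)" for c'
  proof
    assume "V 0 \<in> sel ?V (avail c' ?n)"
    then obtain k where "k \<le> ?m" "V 0 = V (Suc k)" using subA[of c'] by auto
    thus False using V0 by auto
  qed
  have U0U: "U 0 \<notin> sel ?U xs"
  proof
    assume "U 0 \<in> sel ?U xs"
    then obtain k where "k < ?m" "U 0 = U (Suc k)" using subU[of xs] by auto
    thus False using U0 by auto
  qed
  have U0V: "U 0 \<notin> sel ?V (avail c' ?n)" for c'
  proof
    assume "U 0 \<in> sel ?V (avail c' ?n)"
    then obtain k where "k \<le> ?m" "U 0 = V (Suc k)" using subA[of c'] by auto
    thus False using UV[of 0 "Suc k"] by auto
  qed
  have V0R: "V 0 \<in> ?R \<longleftrightarrow> \<not> c"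
    using notU[of 0] V0V[of False] UV[of 0 0] VD[of 0] by auto
  have V1R: "V 1 \<in> ?R \<longleftrightarrow> 0 < ?n"
  proof
    assume "0 < ?n"
    then obtain j where "?n = Suc j" by (cases ?n) auto
    thus "V 1 \<in> ?R" by auto
  next
    assume *: "V 1 \<in> ?R"
    show "0 < ?n"
    proof (rule ccontr)
      assume "\<not> 0 < ?n"
      hence n: "xs = []" "\<not> l" by auto
      show False using * V0[of 0] UV[of 0 1] VD[of 1] by (auto simp: n split: if_splits)
    qed
  qed
  have rem0: "?R - {U 0, V 0} = sel ?U xs \<union> sel ?V (avail False ?n) \<union> D"
    if x
    using that U0U U0V[of False] V0V[of False] notU[of 0] UV[of 0 0] UD[of 0] VD[of 0] by auto
  have rem1: "?R - {U 0, V 1}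
      = sel ?U xs \<union> sel ?V (avail True ?n) \<union> (if c then D else insert (V 0) D)"
    if x: x and n: "0 < ?n"
  proof -
    obtain j where j: "?n = Suc j" using n by (cases ?n) auto
    have "V 1 \<notin> sel (\<lambda>k. V (Suc (Suc k))) (avail False j)"
    proof
      assume "V 1 \<in> sel (\<lambda>k. V (Suc (Suc k))) (avail False j)"
      then obtain k where "k < j" "V 1 = V (Suc (Suc k))"
        using sel_subset[of "\<lambda>k. V (Suc (Suc k))" "avail False j"] by auto
      moreover have "j \<le> ?m" using j by (cases l) auto
      ultimately show False using inj_onD[OF Cons.prems(4), of 1 "Suc (Suc k)"] by auto
    qed
    moreover have "V 1 \<noteq> V 0" using V0[of 0] by auto
    ultimately show ?thesis
      using x U0U U0V[of True] notU[of 1] UV[of 0 0] UV[of 0 1] UD[of 0] VD[of 1]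
      unfolding j by auto
  qed
  let ?f = "\<lambda>c' D'. \<Sum>Y\<in>blists ?n. of_bool (slides l c' xs Y) * num_tilings (sel ?V (map Not Y) \<union> D')"
  have n0: "?f True D' = 0" if "\<not> 0 < ?n" for D'
    using that by auto
  have l: "l \<or> xs \<noteq> []" if "0 < ?n" using that by auto
  show ?case
  proof (cases x)
    case False
    show ?thesis
    proof (cases c)
      case True
      thus ?thesis unfolding step sum_blists_Suc
        using False IH[of D False] by (simp add: Un_assoc)
    next
      case c: False
      have "?R = sel ?U xs \<union> sel ?V (avail False ?n) \<union> insert (V 0) D"
        using False c by auto
      thus ?thesis unfolding step sum_blists_Suc
        using False c IH[of "insert (V 0) D" False] by simp
    qed
  next
    case True
    have exp: "num_tilings ?R = (\<Sum>s\<in>?R \<inter> {V 0, V 1}. num_tilings (?R - {U 0, s}))"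
      using num_tilings_expand[OF finR, of "U 0"] True unfolding nb by simp
    have t1: "num_tilings (?R - {U 0, V 1}) = ?f True (if c then D else insert (V 0) D)" if "0 < ?n"
      unfolding rem1[OF True that] using l[OF that] by (intro IH) auto
    have t0: "num_tilings (?R - {U 0, V 0}) = ?f False D"
      unfolding rem0[OF True] by (intro IH) auto
    show ?thesis
    proof (cases c)
      case c: True
      have "?R \<inter> {V 0, V 1} = (if 0 < ?n then {V 1} else {})"
        using V0R V1R c by auto
      hence "num_tilings ?R = (if 0 < ?n then num_tilings (?R - {U 0, V 1}) else 0)"
        unfolding exp by (simp del: sel_Cons avail.simps)
      also have "\<dots> = ?f True D"
        using t1 n0 c by (auto simp del: sel_Cons avail.simps)
      finally have "num_tilings ?R = ?f True D" .
      thus ?thesis unfolding step sum_blists_Suc using True c by simp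
    next
      case c: False
      have "?R \<inter> {V 0, V 1} = (if 0 < ?n then {V 0, V 1} else {V 0})"
        using V0R V1R c by auto
      hence "num_tilings ?R = num_tilings (?R - {U 0, V 0})
          + (if 0 < ?n then num_tilings (?R - {U 0, V 1}) else 0)"
        unfolding exp using V0[of 0] by (simp del: sel_Cons avail.simps)
      also have "\<dots> = ?f False D + ?f True (insert (V 0) D)"
        unfolding t0 using t1 n0 c by (auto simp del: sel_Cons avail.simps)
      finally have "num_tilings ?R = ?f False D + ?f True (insert (V 0) D)" .
      thus ?thesis unfolding step sum_blists_Suc using True c by (simp add: sum.distrib)
    qed
  qed
qed

section \<open>The shape of the region\<close>

definition vedge :: "int \<Rightarrow> int \<Rightarrow> edge" where
  "vedge i j = {(i, j), (i, j + 1)}"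

definition hedge :: "int \<Rightarrow> int \<Rightarrow> edge" where
  "hedge i j = {(i, j), (i + 1, j)}"

lemma vedge_eq_iff [simp]: "vedge i j = vedge i' j' \<longleftrightarrow> i = i' \<and> j = j'"
  by (auto simp: vedge_def doubleton_eq_iff)

lemma vedge_neq_hedge [simp]: "vedge i j \<noteq> hedge i' j'" "hedge i' j' \<noteq> vedge i j"
  by (auto simp: vedge_def hedge_def doubleton_eq_iff)

lemma diagonal_neq [simp]:
  "{(i, j), (i + 1, j + 1)} \<noteq> vedge i' j'" "{(i, j), (i + 1, j + 1)} \<noteq> hedge i' j'"
  "vedge i' j' \<noteq> {(i, j), (i + 1, j + 1)}" "hedge i' j' \<noteq> {(i, j), (i + 1, j + 1)}"
  by (auto simp: vedge_def hedge_def doubleton_eq_iff)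

lemma path_edges_iff:
  "e \<in> path_edges P \<longleftrightarrow> (\<exists>i. Suc i < length P \<and> e = {P ! i, P ! Suc i})"
  by (auto simp: path_edges_def)

lemma path_edges_Cons: "path_edges (p # q # P) = insert {p, q} (path_edges (q # P))"
proof (rule set_eqI)
  fix e
  have "Suc i < length (p # q # P) \<and> e = {(p # q # P) ! i, (p # q # P) ! Suc i} \<longleftrightarrow>
      i = 0 \<and> e = {p, q} \<or> (\<exists>k. i = Suc k \<and> Suc k < length (q # P) \<and> e = {(q # P) ! k, (q # P) ! Suc k})"
    for i by (cases i) auto
  thus "e \<in> path_edges (p # q # P) \<longleftrightarrow> e \<in> insert {p, q} (path_edges (q # P))"
    unfolding path_edges_iff insert_iff by metis
qed

lemma path_edges_single: "path_edges [p] = {}"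
  by (simp add: path_edges_def)

lemma zigzag_eq_Cons: "\<exists>P. zigzag n u v p = p # P"
  by (cases n) auto

lemma path_edges_zigzag_Suc:
  "path_edges (zigzag (Suc n) u v p)
     = {{p, p + u}, {p + u, p + u + v}} \<union> path_edges (zigzag n u v (p + u + v))"
  using zigzag_eq_Cons[of n u v "p + u + v"] by (auto simp: path_edges_Cons)

lemma Collect_image_insert: "{f i | i. i = x \<or> Q i} = insert (f x) {f i | i. Q i}"
  by blast

lemma path_edges_zigzag_up:
  "path_edges (zigzag n (0, 1) (1, 0) (x, y))
     = {vedge i (i + (y - x)) | i. x \<le> i \<and> i < x + int n}
     \<union> {hedge i (i + (y - x) + 1) | i. x \<le> i \<and> i < x + int n}"
proof (induction n arbitrary: x y)
  case 0
  show ?case by (simp add: path_edges_single)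
next
  case (Suc n)
  have *: "x \<le> i \<and> i < x + int (Suc n) \<longleftrightarrow> i = x \<or> x + 1 \<le> i \<and> i < x + 1 + int n" for i
    by auto
  have "{(x, y), (x, y + 1)} = vedge x (x + (y - x))"
    "{(x, y + 1), (x + 1, y + 1)} = hedge x (x + (y - x) + 1)"
    by (auto simp: vedge_def hedge_def)
  moreover have "path_edges (zigzag (Suc n) (0, 1) (1, 0) (x, y))
      = {{(x, y), (x, y + 1)}, {(x, y + 1), (x + 1, y + 1)}}
        \<union> path_edges (zigzag n (0, 1) (1, 0) (x + 1, y + 1))"
    using path_edges_zigzag_Suc[of n "(0, 1)" "(1, 0)" "(x, y)"] by simp
  moreover have "y + 1 - (x + 1) = y - x" by simp
  ultimately show ?case unfolding Suc.IH * Collect_image_insert by (simp only:) blast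
qed

lemma path_edges_zigzag_down:
  "path_edges (zigzag n (0, -1) (-1, 0) (x, y))
     = {vedge (i + 1) (i + (y - x)) | i. x - int n \<le> i \<and> i < x}
     \<union> {hedge i (i + (y - x)) | i. x - int n \<le> i \<and> i < x}"
proof (induction n arbitrary: x y)
  case 0
  show ?case by (simp add: path_edges_single)
next
  case (Suc n)
  have *: "x - int (Suc n) \<le> i \<and> i < x \<longleftrightarrow> i = x - 1 \<or> x - 1 - int n \<le> i \<and> i < x - 1" for i
    by auto
  have "{(x, y), (x, y - 1)} = vedge (x - 1 + 1) (x - 1 + (y - x))"
    "{(x, y - 1), (x - 1, y - 1)} = hedge (x - 1) (x - 1 + (y - x))"
    by (auto simp: vedge_def hedge_def)
  moreover have "path_edges (zigzag (Suc n) (0, -1) (-1, 0) (x, y))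
      = {{(x, y), (x, y - 1)}, {(x, y - 1), (x - 1, y - 1)}}
        \<union> path_edges (zigzag n (0, -1) (-1, 0) (x - 1, y - 1))"
    using path_edges_zigzag_Suc[of n "(0, -1)" "(-1, 0)" "(x, y)"] by simp
  moreover have "y - 1 - (x - 1) = y - x" by simp
  ultimately show ?case unfolding Suc.IH * Collect_image_insert by (simp only:) blast
qed

lemma path_edges_map_upt:
  "path_edges (map f [0..<Suc m]) = {{f n, f (Suc n)} | n. n < m}"
  unfolding path_edges_def
  by (intro Collect_cong ex_cong1) (auto simp: nth_append simp del: upt_Suc)

lemma path_edges_rev: "path_edges (rev P) = path_edges P"
proof -
  have sub: "path_edges (rev Q) \<subseteq> path_edges Q" for Q
  proof
    fix e assume "e \<in> path_edges (rev Q)"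
    then obtain i where i: "Suc i < length Q" "e = {rev Q ! i, rev Q ! Suc i}"
      by (auto simp: path_edges_def)
    let ?j = "length Q - Suc (Suc i)"
    have "Suc ?j = length Q - Suc i" using i by simp
    hence "e = {Q ! ?j, Q ! Suc ?j}" using i by (auto simp: rev_nth insert_commute)
    moreover have "Suc ?j < length Q" using i by simp
    ultimately show "e \<in> path_edges Q" unfolding path_edges_def by blast
  qed
  show ?thesis using sub[of P] sub[of "rev P"] by auto
qed

lemma common_edge_cases:
  assumes "e \<in> edges r" "e \<in> edges s"
  obtains "corner r = corner s"
  | i j where "e = vedge i j" "{corner r, corner s} = {(i, j), (i - 1, j)}"
  | i j where "e = hedge i j" "{corner r, corner s} = {(i, j), (i, j - 1)}"
proof -
  have edge: "\<exists>i j. corner t = (i, j) \<and> (e = vedge i j \<or> e = vedge (i + 1) j \<or> e = hedge i j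
      \<or> e = hedge i (j + 1) \<or> e = {(i, j), (i + 1, j + 1)})" if "e \<in> edges t" for t
    using that by (cases t rule: edges.cases) (auto simp: vedge_def hedge_def)
  obtain i j where 1: "corner r = (i, j)" "e = vedge i j \<or> e = vedge (i + 1) j \<or> e = hedge i j
      \<or> e = hedge i (j + 1) \<or> e = {(i, j), (i + 1, j + 1)}"
    using edge[OF assms(1)] by blast
  obtain i' j' where 2: "corner s = (i', j')" "e = vedge i' j' \<or> e = vedge (i' + 1) j' \<or> e = hedge i' j'
      \<or> e = hedge i' (j' + 1) \<or> e = {(i', j'), (i' + 1, j' + 1)}"
    using edge[OF assms(2)] by blast
  have hedge_eq: "hedge x y = hedge x' y' \<longleftrightarrow> x = x' \<and> y = y'" for x y x' y'
    by (auto simp: hedge_def doubleton_eq_iff)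
  have diag_eq: "{(x, y), (x + 1, y + 1)} = {(x', y'), (x' + 1, y' + 1)} \<longleftrightarrow> x = x' \<and> y = y'"
    for x y x' y' :: int by (auto simp: doubleton_eq_iff)
  have "corner r = corner s
      \<or> (\<exists>i j. e = vedge i j \<and> {corner r, corner s} = {(i, j), (i - 1, j)})
      \<or> (\<exists>i j. e = hedge i j \<and> {corner r, corner s} = {(i, j), (i, j - 1)})"
    using 1(2)
  proof (elim disjE)
    assume e: "e = vedge i j"
    thus ?thesis using 1(1) 2 by (auto simp: doubleton_eq_iff)
  next
    assume e: "e = vedge (i + 1) j"
    thus ?thesis using 1(1) 2 by (auto simp: doubleton_eq_iff)
  next
    assume e: "e = hedge i j"
    thus ?thesis using 1(1) 2 by (auto simp: doubleton_eq_iff hedge_eq)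
  next
    assume e: "e = hedge i (j + 1)"
    thus ?thesis using 1(1) 2 by (auto simp: doubleton_eq_iff hedge_eq)
  next
    assume e: "e = {(i, j), (i + 1, j + 1)}"
    thus ?thesis using 1(1) 2 by (simp add: diag_eq)
  qed
  thus thesis using that by blast
qed

lemma corner_upper [simp]: "corner (upper_piece ds p) = p"
  by (simp add: upper_piece_def)

lemma corner_lower [simp]: "corner (lower_piece ds p) = p"
  by (simp add: lower_piece_def)

locale douglas =
  fixes a :: nat and ds :: "nat list"
  assumes a_pos: "0 < a" and pos: "\<forall>d\<in>set ds. 0 < d" and adm: "douglas_admissible a ds"
begin

text \<open>
  Row \<open>n\<close> consists of the squares whose lower left corner has offset \<open>- n\<close>; \<open>dark n\<close> says that their
  lower pieces are black. Row \<open>n\<close> of the region is cut out by the abscissas \<open>lf n\<close> and \<open>rt n\<close> of the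
  boundary points of the same offset.
\<close>

definition len :: nat where
  "len = sum_list ds"

definition dark :: "nat \<Rightarrow> bool" where
  "dark n \<longleftrightarrow> odd (depth ds (- int n)) \<noteq> (- int n \<in> drawn ds)"

definition rt :: "nat \<Rightarrow> int" where
  "rt n = fst (ne_point ds n)"

definition lf :: "nat \<Rightarrow> int" where
  "lf n = int n - int a - rt n"

lemma lower_black: "offset p = - int n \<Longrightarrow> lower_piece ds p \<in> black ds \<longleftrightarrow> dark n"
  using piece_in_fundamental(2)[of ds p]
  by (auto simp: black_eq[OF pos] dark_def lower_piece_def)

lemma upper_black: "upper_piece ds p \<in> black ds \<longleftrightarrow> odd (depth ds (offset p))"
  using piece_in_fundamental(1)[of ds p]
  by (auto simp: black_eq[OF pos] upper_piece_def)

lemma depth_Suc_dark: "odd (depth ds (- int (Suc n))) \<longleftrightarrow> \<not> dark n"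
proof -
  have "- int (Suc n) = - int n - 1" by simp
  thus ?thesis unfolding dark_def by (simp only: depth_step) auto
qed

lemma dark_Suc: "dark (Suc n) \<longleftrightarrow> (\<not> dark n) \<noteq> (- int (Suc n) \<in> drawn ds)"
  by (simp add: dark_def[of "Suc n"] depth_Suc_dark del: of_nat_Suc)

lemma ne_point_eq: "ne_point ds n = (rt n, rt n - int n)"
  using offset_ne_point[of ds n] by (cases "ne_point ds n") (auto simp: rt_def offset_def)

lemma rt_0 [simp]: "rt 0 = 0"
  by (simp add: rt_def)

lemma rt_Suc [simp]: "rt (Suc n) = rt n + of_bool (\<not> dark n)"
  using lower_black[of "(rt n - 1, rt n - int n - 1)" n]
  by (auto simp: rt_def[of "Suc n"] ne_point_eq offset_def)

lemma lf_0 [simp]: "lf 0 = - int a"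
  by (simp add: lf_def)

lemma lf_Suc [simp]: "lf (Suc n) = lf n + of_bool (dark n)"
  by (simp add: lf_def)

lemma reflect_ne_point: "reflect a (ne_point ds n) = (lf n, lf n - int n)"
  by (simp add: ne_point_eq reflect_def lf_def)

lemma lf_less_rt: "n \<le> len \<Longrightarrow> lf n < rt n"
proof (induction n)
  case (Suc n)
  have "ne_point ds (Suc n) \<noteq> reflect a (ne_point ds (Suc n))"
  proof -
    have "ne_point ds (Suc n) \<in> set (ne_boundary ds)"
      using Suc.prems by (simp add: ne_boundary_eq[OF pos] len_def del: upt_Suc ne_point.simps)
    moreover from this have "reflect a (ne_point ds (Suc n)) \<in> set (sw_boundary a ds)"
      by (simp add: sw_boundary_def del: ne_point.simps)
    ultimately show ?thesis using adm unfolding douglas_admissible_def by (metis IntI emptyE)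
  qed
  hence "rt (Suc n) \<noteq> lf (Suc n)"
    using ne_point_eq[of "Suc n"] reflect_ne_point[of "Suc n"] by metis
  thus ?case using Suc by (auto split: if_splits)
qed (use a_pos in simp)

lemma dark_len: "\<not> dark len"
proof -
  have "- int len \<notin> drawn ds" using drawn_neg[OF pos] by (force simp: lower_offset_def len_def)
  moreover have "Square (0, - int len) \<notin> black ds"
    using adm by (auto simp: douglas_admissible_def offset_def lower_offset_def len_def)
  ultimately show ?thesis
    using lower_black[of "(0, - int len)" len] by (auto simp: lower_piece_def offset_def)
qed

lemma vertex_B_eq: "vertex_B ds = (rt len, rt len - int len)"
  by (simp add: vertex_B_def ne_boundary_eq[OF pos] ne_point_eq len_def)

lemma boundary_eq:
  "boundary_edges a ds =
     {vedge i i | i. - int a \<le> i \<and> i < 0} \<union> {hedge i (i + 1) | i. - int a \<le> i \<and> i < 0}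
   \<union> {if dark n then vedge (rt n) (rt n - int n - 1) else hedge (rt n) (rt n - int n) | n. n < len}
   \<union> {vedge (i + 1) (i - int len) | i. lf len \<le> i \<and> i < rt len}
   \<union> {hedge i (i - int len) | i. lf len \<le> i \<and> i < rt len}
   \<union> {if dark n then hedge (lf n) (lf n - int n) else vedge (lf n) (lf n - int n - 1) | n. n < len}"
proof -
  have top: "path_edges (top_zigzag a)
      = {vedge i i | i. - int a \<le> i \<and> i < 0} \<union> {hedge i (i + 1) | i. - int a \<le> i \<and> i < 0}"
    using path_edges_zigzag_up[of a "- int a" "- int a"]
    by (simp add: top_zigzag_def vertex_D_def vertex_A_def)
  have "path_edges (ne_boundary ds) = {{ne_point ds n, ne_point ds (Suc n)} | n. n < len}"
    unfolding ne_boundary_eq[OF pos] path_edges_map_upt len_def ..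
  moreover have "{ne_point ds n, ne_point ds (Suc n)}
      = (if dark n then vedge (rt n) (rt n - int n - 1) else hedge (rt n) (rt n - int n))" for n
    by (auto simp: ne_point_eq vedge_def hedge_def simp del: ne_point.simps)
  ultimately have ne: "path_edges (ne_boundary ds) = {if dark n then vedge (rt n) (rt n - int n - 1)
      else hedge (rt n) (rt n - int n) | n. n < len}" by simp
  have "path_edges (sw_boundary a ds)
      = {{reflect a (ne_point ds n), reflect a (ne_point ds (Suc n))} | n. n < len}"
    unfolding sw_boundary_def rev_map[symmetric] path_edges_rev ne_boundary_eq[OF pos] map_map
      path_edges_map_upt len_def comp_def ..
  moreover have "{reflect a (ne_point ds n), reflect a (ne_point ds (Suc n))}
      = (if dark n then hedge (lf n) (lf n - int n) else vedge (lf n) (lf n - int n - 1))" for n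
    by (auto simp: reflect_ne_point vedge_def hedge_def simp del: ne_point.simps)
  ultimately have sw: "path_edges (sw_boundary a ds) = {if dark n then hedge (lf n) (lf n - int n)
      else vedge (lf n) (lf n - int n - 1) | n. n < len}" by simp
  have C: "vertex_C a ds = (lf len, lf len - int len)"
    by (simp add: vertex_C_def vertex_B_eq reflect_def lf_def)
  have "rt len - int (nat (rt len - lf len)) = lf len" using lf_less_rt[of len] by simp
  hence bot: "path_edges (bottom_zigzag a ds)
      = {vedge (i + 1) (i - int len) | i. lf len \<le> i \<and> i < rt len}
      \<union> {hedge i (i - int len) | i. lf len \<le> i \<and> i < rt len}"
    using path_edges_zigzag_down[of "nat (rt len - lf len)" "rt len" "rt len - int len"]
    by (simp add: bottom_zigzag_def vertex_B_eq C)
  show ?thesis unfolding boundary_edges_def top ne bot sw by blast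
qed

fun inside :: "point \<Rightarrow> bool" where
  "inside (i, j) \<longleftrightarrow> j \<le> i \<and> i - j \<le> int len \<and> lf (nat (i - j)) \<le> i \<and> i < rt (nat (i - j))"

lemma inside_row: "inside (i, i - int n) \<longleftrightarrow> n \<le> len \<and> lf n \<le> i \<and> i < rt n"
  by auto

lemma not_inside_above: "\<not> inside (i, i + 1 + int n)"
  by simp

lemma row_cases:
  obtains (above) n where "j = i + 1 + int n" | (row) n where "j = i - int n"
proof (cases "j \<le> i")
  case True
  thus thesis using row[of "nat (i - j)"] by simp
next
  case False
  thus thesis using above[of "nat (j - i - 1)"] by simp
qed

lemma vedge_separates:
  assumes "inside (i, j) \<noteq> inside (i - 1, j)"
  shows "vedge i j \<in> boundary_edges a ds"
proof (cases rule: row_cases[of j "i - 1"])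
  case (above n)
  have "inside (i, j)" using assms not_inside_above[of "i - 1" n] above by simp
  hence "j = i" "- int a \<le> i" "i < 0" using above by auto
  thus ?thesis unfolding boundary_eq by blast
next
  case (row n)
  have j: "j = i - int (Suc n)" using row by simp
  have "inside (i, j) \<longleftrightarrow> Suc n \<le> len \<and> lf (Suc n) \<le> i \<and> i < rt (Suc n)"
    unfolding j by (rule inside_row)
  moreover have "inside (i - 1, j) \<longleftrightarrow> n \<le> len \<and> lf n \<le> i - 1 \<and> i - 1 < rt n"
    unfolding row by (rule inside_row)
  ultimately have *: "(Suc n \<le> len \<and> lf (Suc n) \<le> i \<and> i < rt (Suc n))
      \<noteq> (n \<le> len \<and> lf n \<le> i - 1 \<and> i - 1 < rt n)"
    using assms by (simp only:) blast
  show ?thesis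
  proof (cases "n < len")
    case True
    show ?thesis
    proof (cases "dark n")
      case d: True
      hence "i = rt n" using * True by auto
      hence "vedge i j = (if dark n then vedge (rt n) (rt n - int n - 1) else hedge (rt n) (rt n - int n))"
        using d j by simp
      thus ?thesis unfolding boundary_eq using True by blast
    next
      case d: False
      hence "i = lf n" using * True by auto
      hence "vedge i j = (if dark n then hedge (lf n) (lf n - int n) else vedge (lf n) (lf n - int n - 1))"
        using d j by simp
      thus ?thesis unfolding boundary_eq using True by blast
    qed
  next
    case False
    hence "n = len" "lf len \<le> i - 1" "i - 1 < rt len" using * by auto
    hence "vedge i j = vedge (i - 1 + 1) (i - 1 - int len) \<and> lf len \<le> i - 1 \<and> i - 1 < rt len"
      using j by simp
    thus ?thesis unfolding boundary_eq by blast
  qed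
qed

lemma hedge_separates:
  assumes "inside (i, j) \<noteq> inside (i, j - 1)"
  shows "hedge i j \<in> boundary_edges a ds"
proof (cases rule: row_cases[of j i])
  case (above n)
  have "inside (i, j - 1)" using assms not_inside_above[of i n] above by simp
  hence "j = i + 1" "- int a \<le> i" "i < 0" using above by auto
  thus ?thesis unfolding boundary_eq by blast
next
  case (row n)
  have j: "j - 1 = i - int (Suc n)" using row by simp
  have "inside (i, j - 1) \<longleftrightarrow> Suc n \<le> len \<and> lf (Suc n) \<le> i \<and> i < rt (Suc n)"
    unfolding j by (rule inside_row)
  moreover have "inside (i, j) \<longleftrightarrow> n \<le> len \<and> lf n \<le> i \<and> i < rt n"
    unfolding row by (rule inside_row)
  ultimately have *: "(n \<le> len \<and> lf n \<le> i \<and> i < rt n)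
      \<noteq> (Suc n \<le> len \<and> lf (Suc n) \<le> i \<and> i < rt (Suc n))"
    using assms by (simp only:) blast
  show ?thesis
  proof (cases "n < len")
    case True
    show ?thesis
    proof (cases "dark n")
      case d: False
      hence "i = rt n" using * True by auto
      hence "hedge i j = (if dark n then vedge (rt n) (rt n - int n - 1) else hedge (rt n) (rt n - int n))"
        using d row by simp
      thus ?thesis unfolding boundary_eq using True by blast
    next
      case d: True
      hence "i = lf n" using * True by auto
      hence "hedge i j = (if dark n then hedge (lf n) (lf n - int n) else vedge (lf n) (lf n - int n - 1))"
        using d row by simp
      thus ?thesis unfolding boundary_eq using True by blast
    qed
  next
    case False
    hence "n = len" "lf len \<le> i" "i < rt len" using * by auto
    thus ?thesis unfolding boundary_eq using row by blast
  qed
qed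

lemma vedge_boundary_inside:
  assumes "vedge i j \<in> boundary_edges a ds"
  shows "inside (i, j) \<or> inside (i - 1, j)"
proof -
  consider "j = i" "- int a \<le> i" "i < 0"
    | n where "n < len" "dark n" "i = rt n" "j = rt n - int n - 1"
    | "j = i - 1 - int len" "lf len \<le> i - 1" "i - 1 < rt len"
    | n where "n < len" "\<not> dark n" "i = lf n" "j = lf n - int n - 1"
    using assms unfolding boundary_eq by (auto split: if_splits)
  thus ?thesis
  proof cases
    case 1
    thus ?thesis by simp
  next
    case (2 n)
    hence j: "j = i - 1 - int n" by simp
    have "inside (i - 1, j)" unfolding j inside_row using 2 lf_less_rt[of n] by simp
    thus ?thesis ..
  next
    case 3
    have "inside (i - 1, j)" unfolding 3(1) inside_row using 3 by simp
    thus ?thesis ..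
  next
    case (4 n)
    hence j: "j = i - int (Suc n)" by simp
    have "inside (i, j)" unfolding j inside_row using 4 lf_less_rt[of n] by simp
    thus ?thesis ..
  qed
qed

lemma rt_mono: "rt n \<le> rt (n + k) \<and> rt (n + k) \<le> rt n + int k"
  by (induction k) auto

lemma lf_mono: "lf n \<le> lf (n + k) \<and> lf (n + k) \<le> lf n + int k"
  by (induction k) auto

text \<open>
  The region is horizontally convex, so from outside one can escape to infinity along a horizontal ray.
\<close>

lemma outside_ray:
  assumes "\<not> inside (i, j)"
  shows "(\<forall>k::nat. \<not> inside (i + int k, j)) \<or> (\<forall>k::nat. \<not> inside (i - int k, j))"
proof (rule ccontr)
  assume "\<not> ?thesis"
  then obtain k k' :: nat where k: "inside (i + int k, j)" "inside (i - int k', j)" by auto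
  define n where "n = nat (i - int k' - j)"
  have n: "nat (i - j) = n + k'" "nat (i + int k - j) = n + k' + k" "nat (i - int k' - j) = n"
    using k by (auto simp: n_def)
  show False
    using assms k lf_mono[of n k'] rt_mono[of "n + k'" k] by (auto simp: n)
qed

lemma crossing_inside:
  assumes "crossing a ds r s"
  shows "inside (corner r) \<longleftrightarrow> inside (corner s)"
proof -
  obtain e where e: "e \<in> edges r" "e \<in> edges s" "e \<notin> boundary_edges a ds"
    using assms by (auto simp: crossing_def)
  from e(1,2) show ?thesis
  proof (cases rule: common_edge_cases)
    case (2 i j)
    hence "inside (i, j) \<longleftrightarrow> inside (i - 1, j)" using vedge_separates e(3) by blast
    thus ?thesis using 2(2) by (auto simp: doubleton_eq_iff)
  next
    case (3 i j)
    hence "inside (i, j) \<longleftrightarrow> inside (i, j - 1)" using hedge_separates e(3) by blast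
    thus ?thesis using 3(2) by (auto simp: doubleton_eq_iff)
  qed simp
qed

definition region :: "piece set" where
  "region = {r \<in> fundamental ds. inside (corner r)}"

lemma finite_region: "finite region"
proof -
  let ?P = "(\<lambda>(n, i). (i, i - int n)) ` (SIGMA n:{..len}. {lf n..<rt n})"
  have "p \<in> ?P" if "inside p" for p
  proof -
    obtain i j where p: "p = (i, j)" by (cases p)
    have "p = (\<lambda>(n, i). (i, i - int n)) (nat (i - j), i)" using that p by simp
    moreover have "(nat (i - j), i) \<in> (SIGMA n:{..len}. {lf n..<rt n})" using that p by auto
    ultimately show ?thesis by blast
  qed
  hence "region \<subseteq> Square ` ?P \<union> Up ` ?P \<union> Down ` ?P"
    unfolding region_def
  proof (intro subsetI)
    fix r assume "\<And>p. inside p \<Longrightarrow> p \<in> ?P" "r \<in> {r \<in> fundamental ds. inside (corner r)}"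
    thus "r \<in> Square ` ?P \<union> Up ` ?P \<union> Down ` ?P" by (cases r) auto
  qed
  thus ?thesis by (rule finite_subset) auto
qed

lemma diagonal_not_boundary: "{(i, j), (i + 1, j + 1)} \<notin> boundary_edges a ds"
  unfolding boundary_eq by auto

lemma crossing_sym: "crossing a ds r s \<Longrightarrow> crossing a ds s r"
  unfolding crossing_def by (simp add: Int_commute eq_commute)

lemma crossing_square:
  "(crossing a ds)\<^sup>*\<^sup>* (upper_piece ds (i, j)) (lower_piece ds (i, j))"
  "(crossing a ds)\<^sup>*\<^sup>* (lower_piece ds (i, j)) (upper_piece ds (i, j))"
proof -
  have "crossing a ds (upper_piece ds (i, j)) (lower_piece ds (i, j))"
    if "j - i \<in> drawn ds"
  proof -
    have "{(i, j), (i + 1, j + 1)} \<in> edges (Up (i, j)) \<inter> edges (Down (i, j)) - boundary_edges a ds"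
      using diagonal_not_boundary[of i j] by simp
    thus ?thesis
      using that piece_in_fundamental[of ds "(i, j)"] unfolding crossing_def
      by (simp add: upper_piece_def lower_piece_def offset_def del: edges.simps) blast
  qed
  moreover have "upper_piece ds (i, j) = lower_piece ds (i, j)" if "j - i \<notin> drawn ds"
    using that by (simp add: upper_piece_def lower_piece_def offset_def)
  ultimately show "(crossing a ds)\<^sup>*\<^sup>* (upper_piece ds (i, j)) (lower_piece ds (i, j))"
    "(crossing a ds)\<^sup>*\<^sup>* (lower_piece ds (i, j)) (upper_piece ds (i, j))"
    using crossing_sym by (cases "j - i \<in> drawn ds"; simp add: r_into_rtranclp)+
qed

lemma crossing_vedge:
  assumes "\<not> inside (i, j)" "\<not> inside (i + 1, j)"
  shows "crossing a ds (lower_piece ds (i, j)) (upper_piece ds (i + 1, j))"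
    "crossing a ds (upper_piece ds (i + 1, j)) (lower_piece ds (i, j))"
proof -
  have "vedge (i + 1) j \<notin> boundary_edges a ds"
    using vedge_boundary_inside[of "i + 1" j] assms by auto
  moreover have "vedge (i + 1) j \<in> edges (lower_piece ds (i, j)) \<inter> edges (upper_piece ds (i + 1, j))"
    by (auto simp: vedge_def lower_piece_def upper_piece_def)
  moreover have "lower_piece ds (i, j) \<noteq> upper_piece ds (i + 1, j)"
    by (auto simp: lower_piece_def upper_piece_def)
  ultimately show "crossing a ds (lower_piece ds (i, j)) (upper_piece ds (i + 1, j))"
    unfolding crossing_def using piece_in_fundamental by blast
  thus "crossing a ds (upper_piece ds (i + 1, j)) (lower_piece ds (i, j))"
    by (rule crossing_sym)
qed

lemma infinite_outside:
  assumes "r \<in> fundamental ds" "\<not> inside (corner r)"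
  shows "infinite {s. (crossing a ds)\<^sup>*\<^sup>* r s}"
proof -
  obtain i j where ij: "corner r = (i, j)" by (cases "corner r")
  have r: "(crossing a ds)\<^sup>*\<^sup>* r (upper_piece ds (i, j)) \<and> (crossing a ds)\<^sup>*\<^sup>* r (lower_piece ds (i, j))"
    using fundamental_cases[OF assms(1)] crossing_square[of i j] ij by auto
  have "\<exists>f :: nat \<Rightarrow> int. inj f \<and> (\<forall>k. \<exists>s. (crossing a ds)\<^sup>*\<^sup>* r s \<and> corner s = (f k, j))"
    using outside_ray[OF assms(2)[unfolded ij]]
  proof (elim disjE)
    assume out: "\<forall>k::nat. \<not> inside (i + int k, j)"
    have "(crossing a ds)\<^sup>*\<^sup>* r (lower_piece ds (i + int k, j))" for k
    proof (induction k)
      case (Suc k)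
      have "crossing a ds (lower_piece ds (i + int k, j)) (upper_piece ds (i + int k + 1, j))"
        using out[rule_format, of k] out[rule_format, of "Suc k"]
        by (intro crossing_vedge) (simp_all add: add_ac del: inside.simps)
      hence "(crossing a ds)\<^sup>*\<^sup>* r (upper_piece ds (i + int (Suc k), j))"
        using Suc by (simp add: add_ac)
      thus ?case using crossing_square(1) by (rule rtranclp_trans)
    qed (use r in simp)
    thus ?thesis by (intro exI[of _ "\<lambda>k. i + int k"]) (fastforce simp: inj_def)
  next
    assume out: "\<forall>k::nat. \<not> inside (i - int k, j)"
    have "(crossing a ds)\<^sup>*\<^sup>* r (upper_piece ds (i - int k, j))" for k
    proof (induction k)
      case (Suc k)
      have "crossing a ds (upper_piece ds (i - int (Suc k) + 1, j)) (lower_piece ds (i - int (Suc k), j))"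
        using out[rule_format, of k] out[rule_format, of "Suc k"]
        by (intro crossing_vedge) (simp_all del: inside.simps)
      hence "(crossing a ds)\<^sup>*\<^sup>* r (lower_piece ds (i - int (Suc k), j))"
        using Suc by simp
      thus ?case using crossing_square(2) by (rule rtranclp_trans)
    qed (use r in simp)
    thus ?thesis by (intro exI[of _ "\<lambda>k. i - int k"]) (fastforce simp: inj_def)
  qed
  then obtain f :: "nat \<Rightarrow> int" where f: "inj f"
    "\<And>k. \<exists>s. (crossing a ds)\<^sup>*\<^sup>* r s \<and> corner s = (f k, j)" by blast
  have "range f \<subseteq> (fst \<circ> corner) ` {s. (crossing a ds)\<^sup>*\<^sup>* r s}"
  proof
    fix x assume "x \<in> range f"
    then obtain k where "x = f k" by blast
    moreover obtain s where "(crossing a ds)\<^sup>*\<^sup>* r s" "corner s = (f k, j)" using f(2) by blast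
    ultimately show "x \<in> (fst \<circ> corner) ` {s. (crossing a ds)\<^sup>*\<^sup>* r s}" by force
  qed
  moreover have "infinite (range f)" using finite_imageD[OF _ f(1)] by auto
  ultimately show ?thesis using finite_subset finite_imageI by blast
qed

lemma douglas_region_eq: "douglas_region a ds = region"
proof -
  have "finite {s. (crossing a ds)\<^sup>*\<^sup>* r s}" if r: "r \<in> region" for r
  proof -
    have "s \<in> region" if "(crossing a ds)\<^sup>*\<^sup>* r s" for s
      using that
    proof induction
      case (step s t)
      thus ?case using crossing_inside[of s t] by (auto simp: region_def crossing_def)
    qed (fact r)
    hence "{s. (crossing a ds)\<^sup>*\<^sup>* r s} \<subseteq> region" by blast
    thus ?thesis using finite_region by (rule finite_subset)
  qed
  thus ?thesis using infinite_outside by (auto simp: douglas_region_def region_def)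
qed

end

section \<open>Tilings as routes\<close>

lemma share_edge_lower_below:
  assumes "s \<in> fundamental ds" "offset (corner s) < j - i"
  shows "share_edge (lower_piece ds (i, j)) s
    \<longleftrightarrow> s = upper_piece ds (i, j - 1) \<or> s = upper_piece ds (i + 1, j)"
proof
  assume *: "share_edge (lower_piece ds (i, j)) s"
  show "s = upper_piece ds (i, j - 1) \<or> s = upper_piece ds (i + 1, j)"
    using assms *
    by (cases s rule: edges.cases)
      (auto simp: share_edge_def lower_piece_def upper_piece_def fundamental_def offset_def
        doubleton_eq_iff split: if_splits)
next
  assume "s = upper_piece ds (i, j - 1) \<or> s = upper_piece ds (i + 1, j)"
  thus "share_edge (lower_piece ds (i, j)) s"
    using share_edge_vertical[of ds i "j - 1"] share_edge_horizontal[of ds i j] by auto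
qed

lemma not_share_edge_lower:
  assumes "offset p = offset q"
  shows "\<not> share_edge (lower_piece ds p) (lower_piece ds q)"
  using assms by (cases p; cases q)
    (auto simp: share_edge_def lower_piece_def offset_def doubleton_eq_iff split: if_splits)

lemma share_edge_Up_below:
  assumes "s \<in> fundamental ds" "offset (corner s) \<le> offset p" "offset p \<in> drawn ds"
  shows "share_edge (Up p) s \<longleftrightarrow> s = Down p"
proof
  assume *: "share_edge (Up p) s"
  show "s = Down p"
    using assms *
    by (cases s rule: edges.cases; cases p)
      (auto simp: share_edge_def fundamental_def offset_def doubleton_eq_iff split: if_splits)
next
  assume "s = Down p"
  thus "share_edge (Up p) s" by (simp add: share_edge_same_square)
qed

context douglas
begin

definition sz :: "nat \<Rightarrow> nat" where
  "sz n = nat (rt n - lf n)"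

definition cell :: "nat \<Rightarrow> nat \<Rightarrow> point" where
  "cell n k = (lf n + int k, lf n + int k - int n)"

definition up :: "nat \<Rightarrow> nat \<Rightarrow> piece" where
  "up n k = upper_piece ds (cell n k)"

definition dn :: "nat \<Rightarrow> nat \<Rightarrow> piece" where
  "dn n k = lower_piece ds (cell n k)"

lemma offset_cell [simp]: "offset (cell n k) = - int n"
  by (simp add: offset_def cell_def)

lemma cell_eq_iff [simp]: "cell n k = cell n k' \<longleftrightarrow> k = k'"
  by (auto simp: cell_def)

lemma corner_up [simp]: "corner (up n k) = cell n k"
  by (simp add: up_def)

lemma corner_dn [simp]: "corner (dn n k) = cell n k"
  by (simp add: dn_def)

lemma up_inj [simp]: "up n k = up n k' \<longleftrightarrow> k = k'"
  by (metis corner_up cell_eq_iff)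

lemma dn_inj [simp]: "dn n k = dn n k' \<longleftrightarrow> k = k'"
  by (metis corner_dn cell_eq_iff)

lemma up_fundamental [simp]: "up n k \<in> fundamental ds"
  by (simp add: up_def piece_in_fundamental)

lemma dn_fundamental [simp]: "dn n k \<in> fundamental ds"
  by (simp add: dn_def piece_in_fundamental)

lemma inside_cell: "inside (cell n k) \<longleftrightarrow> n \<le> len \<and> k < sz n"
  unfolding cell_def inside_row sz_def by auto

lemma inside_obtain_cell:
  assumes "inside p"
  obtains n k where "p = cell n k" "n \<le> len" "k < sz n"
proof -
  obtain i j where p: "p = (i, j)" by (cases p)
  have "p = cell (nat (i - j)) (nat (i - lf (nat (i - j))))"
    using assms by (auto simp: p cell_def)
  thus thesis using that assms inside_cell by metis
qed

lemma region_cases: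
  assumes "r \<in> region"
  obtains n k where "r = up n k \<or> r = dn n k" "n \<le> len" "k < sz n"
proof -
  have r: "r \<in> fundamental ds" "inside (corner r)" using assms by (auto simp: region_def)
  obtain n k where "corner r = cell n k" "n \<le> len" "k < sz n"
    using inside_obtain_cell[OF r(2)] .
  thus thesis using that fundamental_cases[OF r(1)] by (auto simp: up_def dn_def)
qed

lemma up_region [simp]: "up n k \<in> region \<longleftrightarrow> n \<le> len \<and> k < sz n"
  by (simp add: region_def inside_cell)

lemma dn_region [simp]: "dn n k \<in> region \<longleftrightarrow> n \<le> len \<and> k < sz n"
  by (simp add: region_def inside_cell)

definition below :: "nat \<Rightarrow> piece set" where
  "below n = {r \<in> region. offset (corner r) < - int n}"

text \<open>What remains of the rows from \<open>n\<close> on without the upper pieces of row \<open>n\<close>.\<close>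

definition lower_rest :: "nat \<Rightarrow> piece set" where
  "lower_rest n = (if - int n \<in> drawn ds then dn n ` {..<sz n} else {}) \<union> below n"

lemma finite_below [simp]: "finite (below n)"
  using finite_region by (simp add: below_def)

lemma finite_lower_rest [simp]: "finite (lower_rest n)"
  by (simp add: lower_rest_def)

lemma up_eq_dn: "- int n \<notin> drawn ds \<Longrightarrow> up n = dn n"
  by (rule ext) (simp add: up_def dn_def upper_piece_def lower_piece_def)

lemma region_eq: "region = dn 0 ` {..<sz 0} \<union> below 0"
proof (intro equalityI subsetI)
  fix r assume r: "r \<in> region"
  then obtain n k where n: "r = up n k \<or> r = dn n k" "n \<le> len" "k < sz n" by (rule region_cases)
  have "0 \<notin> drawn ds" using drawn_neg[OF pos, of 0] by auto
  hence "up 0 = dn 0" by (intro up_eq_dn) simp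
  thus "r \<in> dn 0 ` {..<sz 0} \<union> below 0"
    using n r by (cases n) (auto simp: below_def)
qed (auto simp: below_def)

lemma below_eq:
  assumes "n < len"
  shows "below n = up (Suc n) ` {..<sz (Suc n)} \<union> lower_rest (Suc n)"
proof (intro equalityI subsetI)
  fix r assume r: "r \<in> below n"
  then obtain m k where m: "r = up m k \<or> r = dn m k" "m \<le> len" "k < sz m"
    using region_cases[of r] by (auto simp: below_def)
  have "n < m" using r m by (auto simp: below_def)
  show "r \<in> up (Suc n) ` {..<sz (Suc n)} \<union> lower_rest (Suc n)"
  proof (cases "m = Suc n")
    case True
    thus ?thesis using m up_eq_dn[of m] by (auto simp: lower_rest_def)
  next
    case False
    thus ?thesis using r m \<open>n < m\<close> by (auto simp: lower_rest_def below_def)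
  qed
next
  fix r assume "r \<in> up (Suc n) ` {..<sz (Suc n)} \<union> lower_rest (Suc n)"
  thus "r \<in> below n" using assms by (auto simp: lower_rest_def below_def split: if_splits)
qed

lemma below_len: "below len = {}"
proof -
  have False if r: "r \<in> below len" for r
  proof -
    obtain m k where m: "r = up m k \<or> r = dn m k" "m \<le> len" "k < sz m"
      using r region_cases[of r] by (auto simp: below_def)
    thus False using r by (auto simp: below_def)
  qed
  thus ?thesis by blast
qed

lemma sel_split: "sel f ys \<union> sel f (map Not ys) = f ` {..<length ys}"
  unfolding sel_def by force

lemma num_tilings_close_row:
  assumes "length ys = sz n" "n \<le> len"
  shows "num_tilings (sel (up n) ys \<union> lower_rest n)
    = num_tilings (sel (dn n) (if - int n \<in> drawn ds then map Not ys else ys) \<union> below n)"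
proof (cases "- int n \<in> drawn ds")
  case True
  let ?I = "{k. k < length ys \<and> ys ! k}" and ?D = "sel (dn n) (map Not ys) \<union> below n"
  have up: "up n k = Up (cell n k)" and dn: "dn n k = Down (cell n k)" for k
    using True by (simp_all add: up_def dn_def upper_piece_def lower_piece_def)
  have sel: "sel f ys = f ` ?I" for f :: "nat \<Rightarrow> piece"
    unfolding sel_def by (rule setcompr_eq_image)
  have "sel (up n) ys \<union> lower_rest n = up n ` ?I \<union> dn n ` ?I \<union> ?D"
    using True sel_split[of "dn n" ys] assms(1) unfolding sel lower_rest_def by auto
  also have "num_tilings \<dots> = num_tilings ?D"
  proof (rule num_tilings_forced)
    show "up n ` ?I \<inter> dn n ` ?I = {}" unfolding up dn by auto
    show "(up n ` ?I \<union> dn n ` ?I) \<inter> ?D = {}"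
      by (auto simp: below_def sel_def) (auto simp: up dn)
    fix k s assume k: "k \<in> ?I" "s \<in> up n ` ?I \<union> dn n ` ?I \<union> ?D"
    have "s \<in> fundamental ds" "offset (corner s) \<le> - int n"
      using k(2) by (auto simp: below_def sel_def region_def)
    thus "share_edge (up n k) s \<longleftrightarrow> s = dn n k"
      unfolding up dn using True by (intro share_edge_Up_below[where ds = ds]) auto
  qed (auto simp: inj_on_def)
  finally show ?thesis using True by simp
next
  case False
  thus ?thesis using up_eq_dn[of n] by (simp add: lower_rest_def)
qed

text \<open>
  The positions in row \<open>n\<close> whose lower pieces are matched downwards: the particles among white
  pieces, the holes among black ones.
\<close>

definition remaining :: "nat \<Rightarrow> bool list \<Rightarrow> bool list" where
  "remaining n X = (if dark n then map Not X else X)"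

definition rem_region :: "nat \<Rightarrow> bool list \<Rightarrow> piece set" where
  "rem_region n X = sel (dn n) (remaining n X) \<union> below n"

lemma num_tilings_next_row:
  assumes "n < len" "length xs = sz n" "xs \<noteq> []"
    and V: "V = (\<lambda>k. upper_piece ds (lf n + int k, lf n + int k - int n - 1))"
  shows "num_tilings (sel (dn n) xs \<union> sel V (avail c (length xs + of_bool l)) \<union> lower_rest (Suc n))
    = (\<Sum>Y\<in>blists (length xs + of_bool l). of_bool (slides l c xs Y)
         * num_tilings (sel V (map Not Y) \<union> lower_rest (Suc n)))"
proof (rule num_tilings_row)
  have offV: "offset (corner (V k)) = - int n - 1" for k by (simp add: V offset_def)
  have offD: "offset (corner s) \<le> - int n - 1" if "s \<in> lower_rest (Suc n)" for s
    using that by (auto simp: lower_rest_def below_def split: if_splits)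
  have fundD: "s \<in> fundamental ds" if "s \<in> lower_rest (Suc n)" for s
    using that by (auto simp: lower_rest_def below_def region_def split: if_splits)
  show "inj_on V {..length xs}"
  proof (rule inj_onI)
    fix k k' assume "V k = V k'"
    hence "corner (V k) = corner (V k')" by simp
    thus "k = k'" by (simp add: V)
  qed
  show "dn n ` {..<length xs} \<inter> (V ` {..length xs} \<union> lower_rest (Suc n)) = {}"
  proof (intro equals0I)
    fix s assume s: "s \<in> dn n ` {..<length xs} \<inter> (V ` {..length xs} \<union> lower_rest (Suc n))"
    from s have "s \<in> dn n ` {..<length xs}" by blast
    hence "offset (corner s) = - int n" by auto
    moreover from s have "s \<in> V ` {..length xs} \<union> lower_rest (Suc n)" by blast
    hence "offset (corner s) \<le> - int n - 1" using offV offD by auto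
    ultimately show False by simp
  qed
  show "V ` {..length xs} \<inter> lower_rest (Suc n) = {}"
  proof (intro equals0I)
    fix s assume s: "s \<in> V ` {..length xs} \<inter> lower_rest (Suc n)"
    then obtain k where k: "s = V k" by auto
    have "s \<notin> below (Suc n)" using offV[of k] k by (simp add: below_def)
    hence "- int (Suc n) \<in> drawn ds" "\<exists>k'. s = dn (Suc n) k'"
      using s by (auto simp: lower_rest_def split: if_splits)
    thus False using offV[of k] k by (auto simp: V dn_def lower_piece_def upper_piece_def split: if_splits)
  qed
  fix k s assume k: "k < length xs" "s \<in> dn n ` {..<length xs} \<union> V ` {..length xs} \<union> lower_rest (Suc n)"
  have Vk: "V k = upper_piece ds (lf n + int k, lf n + int k - int n - 1)"
    "V (Suc k) = upper_piece ds (lf n + int k + 1, lf n + int k - int n)"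
    by (simp_all add: V algebra_simps)
  show "share_edge (dn n k) s \<longleftrightarrow> s = V k \<or> s = V (Suc k)"
  proof (cases "s \<in> dn n ` {..<length xs}")
    case True
    hence "\<not> share_edge (dn n k) s" by (auto simp: dn_def not_share_edge_lower)
    moreover have "offset (corner s) = - int n" using True by auto
    hence "s \<noteq> V k" "s \<noteq> V (Suc k)" using offV[of k] offV[of "Suc k"] by auto
    ultimately show ?thesis by blast
  next
    case False
    hence "s \<in> fundamental ds" "offset (corner s) < lf n + int k - int n - (lf n + int k)"
      using k(2) offV offD fundD by (auto simp: V piece_in_fundamental offset_def)
    thus ?thesis unfolding dn_def cell_def Vk by (rule share_edge_lower_below)
  qed
qed (use assms in \<open>auto simp: inj_on_def\<close>)

lemma sz_pos: "n \<le> len \<Longrightarrow> 0 < sz n"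
  using lf_less_rt[of n] by (simp add: sz_def)

lemma sz_Suc_light: "n < len \<Longrightarrow> \<not> dark n \<Longrightarrow> sz (Suc n) = Suc (sz n)"
  using lf_less_rt[of n] by (simp add: sz_def)

lemma sz_Suc_dark: "n < len \<Longrightarrow> dark n \<Longrightarrow> sz n = Suc (sz (Suc n))"
  using lf_less_rt[of n] lf_less_rt[of "Suc n"] by (simp add: sz_def)

lemma rem_region_step_light:
  assumes "n < len" "length X = sz n" "\<not> dark n"
  shows "num_tilings (rem_region n X)
    = (\<Sum>Y\<in>blists (Suc (length X)). of_bool (slides True False X Y)
         * num_tilings (rem_region (Suc n) Y))"
proof -
  let ?V = "\<lambda>k. upper_piece ds (lf n + int k, lf n + int k - int n - 1)"
  have V: "?V = up (Suc n)"
    using assms(3) by (auto simp: up_def cell_def algebra_simps)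
  have "below n = sel ?V (avail False (length X + of_bool True)) \<union> lower_rest (Suc n)"
    unfolding V avail_False sel_replicate below_eq[OF assms(1)]
    using sz_Suc_light[OF assms(1,3)] assms(2) by simp
  hence "rem_region n X = sel (dn n) X \<union> sel ?V (avail False (length X + of_bool True))
      \<union> lower_rest (Suc n)"
    using assms(3) by (simp add: rem_region_def remaining_def Un_assoc del: avail.simps)
  hence "num_tilings (rem_region n X) = (\<Sum>Y\<in>blists (length X + of_bool True).
      of_bool (slides True False X Y) * num_tilings (sel ?V (map Not Y) \<union> lower_rest (Suc n)))"
    using num_tilings_next_row[OF assms(1,2), of ?V False True] sz_pos[of n] assms by fastforce
  also have "\<dots> = (\<Sum>Y\<in>blists (Suc (length X)). of_bool (slides True False X Y)
         * num_tilings (rem_region (Suc n) Y))"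
  proof (intro sum.cong arg_cong2[where f = "(*)"] refl)
    fix Y assume "Y \<in> blists (Suc (length X))"
    hence "length (map Not Y) = sz (Suc n)"
      using sz_Suc_light[OF assms(1,3)] assms(2) by (simp add: blists_def)
    from num_tilings_close_row[OF this] assms(1,3)
    show "num_tilings (sel ?V (map Not Y) \<union> lower_rest (Suc n)) = num_tilings (rem_region (Suc n) Y)"
      unfolding V rem_region_def remaining_def dark_Suc by (simp add: comp_def del: of_nat_Suc)
  qed simp
  finally show ?thesis .
qed

lemma rem_region_step_dark:
  assumes "n < len" "length (x # X) = sz n" "dark n"
  shows "num_tilings (rem_region n (x # X))
    = (\<Sum>Y\<in>blists (length X). of_bool (slides False (\<not> x) (map Not X) (map Not Y))
         * num_tilings (rem_region (Suc n) Y))"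
proof -
  let ?V = "\<lambda>k. upper_piece ds (lf n + int k, lf n + int k - int n - 1)"
  let ?X = "map Not (x # X)"
  have V: "(\<lambda>k. ?V (Suc k)) = up (Suc n)"
    using assms(3) by (auto simp: up_def cell_def algebra_simps)
  have sz: "length X = sz (Suc n)" using sz_Suc_dark[OF assms(1,3)] assms(2) by simp
  have "sel ?V (avail True (length ?X + of_bool False)) = sel (\<lambda>k. ?V (Suc k)) (avail False (length X))"
    by simp
  also have "\<dots> = up (Suc n) ` {..<sz (Suc n)}" unfolding V avail_False sel_replicate sz ..
  finally have "rem_region n (x # X) = sel (dn n) ?X
      \<union> sel ?V (avail True (length ?X + of_bool False)) \<union> lower_rest (Suc n)"
    using assms(3) below_eq[OF assms(1)] by (simp add: rem_region_def remaining_def Un_assoc del: avail.simps sel_Cons)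
  hence "num_tilings (rem_region n (x # X)) = (\<Sum>Y\<in>blists (length ?X + of_bool False).
      of_bool (slides False True ?X Y) * num_tilings (sel ?V (map Not Y) \<union> lower_rest (Suc n)))"
    using num_tilings_next_row[OF assms(1), of ?X ?V True False] assms(2)
    by (simp del: avail.simps sel_Cons slides.simps)
  also have "\<dots> = (\<Sum>Y\<in>blists (length X). of_bool (slides False (\<not> x) (map Not X) Y)
      * num_tilings (sel (up (Suc n)) (map Not Y) \<union> lower_rest (Suc n)))"
    unfolding V[symmetric] by (simp add: sum_blists_Suc)
  also have "\<dots> = (\<Sum>Y\<in>blists (length X). of_bool (slides False (\<not> x) (map Not X) (map Not Y))
      * num_tilings (sel (up (Suc n)) (map Not (map Not Y)) \<union> lower_rest (Suc n)))"
    by (rule sum_blists_map_Not[symmetric])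
  also have "\<dots> = (\<Sum>Y\<in>blists (length X). of_bool (slides False (\<not> x) (map Not X) (map Not Y))
         * num_tilings (rem_region (Suc n) Y))"
  proof (intro sum.cong arg_cong2[where f = "(*)"] refl)
    fix Y assume "Y \<in> blists (length X)"
    hence "length Y = sz (Suc n)" using sz by (simp add: blists_def)
    from num_tilings_close_row[OF this] assms(1,3)
    show "num_tilings (sel (up (Suc n)) (map Not (map Not Y)) \<union> lower_rest (Suc n))
        = num_tilings (rem_region (Suc n) Y)"
      unfolding rem_region_def remaining_def dark_Suc by (simp add: comp_def del: of_nat_Suc)
  qed
  finally show ?thesis .
qed

definition step_at :: "nat \<Rightarrow> step" where
  "step_at n = (if dark n then South else East)"

lemma num_tilings_rem_region:
  assumes "n \<le> len" "length X = sz n"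
  shows "num_tilings (rem_region n X) = routes (map step_at [n..<len]) X"
  using assms
proof (induction n arbitrary: X rule: inc_induct)
  case base
  have R: "rem_region len X = sel (dn len) X"
    using dark_len by (simp add: rem_region_def remaining_def below_len)
  have "num_tilings (sel (dn len) X) = of_bool (sel (dn len) X = {})"
    by (rule num_tilings_independent)
      (auto simp: sel_def dn_def not_share_edge_lower)
  also have "sel (dn len) X = {} \<longleftrightarrow> True \<notin> set X"
    by (auto simp: sel_def in_set_conv_nth)
  finally show ?case unfolding R by simp
next
  case (step n)
  have upt: "map step_at [n..<len] = step_at n # map step_at [Suc n..<len]"
    using step.hyps(2) by (simp add: upt_conv_Cons)
  show ?case
  proof (cases "dark n")
    case False
    have "num_tilings (rem_region n X) = (\<Sum>Y\<in>blists (Suc (length X)).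
        of_bool (slides True False X Y) * num_tilings (rem_region (Suc n) Y))"
      using False step by (intro rem_region_step_light) auto
    also have "\<dots> = (\<Sum>Y\<in>blists (Suc (length X)).
        of_bool (slides True False X Y) * routes (map step_at [Suc n..<len]) Y)"
      using sz_Suc_light[OF step.hyps(2) False] step
      by (intro sum.cong refl) (auto simp: blists_def)
    finally show ?thesis unfolding upt using False by (simp add: step_at_def)
  next
    case True
    obtain x X' where X: "X = x # X'"
      using step.prems sz_pos[of n] step.hyps by (cases X) auto
    have "num_tilings (rem_region n X) = (\<Sum>Y\<in>blists (length X').
        of_bool (slides False (\<not> x) (map Not X') (map Not Y)) * num_tilings (rem_region (Suc n) Y))"
      unfolding X using True step X by (intro rem_region_step_dark) auto
    also have "\<dots> = (\<Sum>Y\<in>blists (length X').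
        of_bool (slides False (\<not> x) (map Not X') (map Not Y)) * routes (map step_at [Suc n..<len]) Y)"
      using sz_Suc_dark[OF step.hyps(2) True] step X
      by (intro sum.cong refl) (auto simp: blists_def)
    finally show ?thesis unfolding upt X using True by (simp add: step_at_def)
  qed
qed

lemma depth_0: "depth ds 0 = 0"
proof -
  have none: "{e \<in> drawn ds. 0 < e} = {}" using drawn_neg[OF pos] by force
  show ?thesis unfolding depth_def none by simp
qed

lemma sz_0: "sz 0 = a"
  by (simp add: sz_def)

lemma num_tilings_region: "num_tilings region = routes (map step_at [0..<len]) (replicate a True)"
proof -
  have "\<not> dark 0" using depth_0 drawn_neg[OF pos, of 0] by (auto simp: dark_def)
  hence "rem_region 0 (replicate a True) = region"
    by (simp add: rem_region_def remaining_def sel_replicate region_eq sz_0)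
  thus ?thesis using num_tilings_rem_region[of 0 "replicate a True"] by (simp add: sz_0)
qed

lemma count_East: "int (count_list (map step_at [0..<n]) East) = rt n"
  by (induction n) (auto simp: step_at_def)

lemma count_South: "int (count_list (map step_at [0..<n]) South) = int n - rt n"
  by (induction n) (auto simp: step_at_def)

lemma regular_cells_eq:
  "regular_cells a ds = (\<Union>n\<in>{n. n < len \<and> \<not> dark n}. up (Suc n) ` {..<sz (Suc n)})"
proof (intro equalityI subsetI)
  fix r assume "r \<in> regular_cells a ds"
  hence r: "r \<in> region" "r \<in> black ds" "\<exists>p. r = Square p \<or> r = Up p"
    by (auto simp: regular_cells_def douglas_region_eq)
  obtain m k where m: "r = up m k \<or> r = dn m k" "m \<le> len" "k < sz m"
    using r(1) by (rule region_cases)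
  have up: "r = up m k"
    using m(1) r(3) by (auto simp: up_def dn_def upper_piece_def lower_piece_def)
  hence odd: "odd (depth ds (- int m))" using r(2) by (simp add: up_def upper_black)
  then obtain n where n: "m = Suc n" using depth_0 by (cases m) auto
  hence "\<not> dark n" using odd depth_Suc_dark by simp
  thus "r \<in> (\<Union>n\<in>{n. n < len \<and> \<not> dark n}. up (Suc n) ` {..<sz (Suc n)})"
    using up m n by (intro UN_I[of n]) auto
next
  fix r assume "r \<in> (\<Union>n\<in>{n. n < len \<and> \<not> dark n}. up (Suc n) ` {..<sz (Suc n)})"
  then obtain n k where n: "n < len" "\<not> dark n" "r = up (Suc n) k" "k < sz (Suc n)" by auto
  hence "r \<in> black ds" using depth_Suc_dark[of n] by (simp add: up_def upper_black)
  moreover have "\<exists>p. r = Square p \<or> r = Up p" using n(3) by (simp add: up_def upper_piece_def)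
  ultimately show "r \<in> regular_cells a ds" using n by (simp add: regular_cells_def douglas_region_eq)
qed

lemma card_regular_cells:
  "int (card (regular_cells a ds)) = black_count (int a) (map step_at [0..<len])"
proof -
  have "card (regular_cells a ds) = (\<Sum>n\<in>{n. n < len \<and> \<not> dark n}. card (up (Suc n) ` {..<sz (Suc n)}))"
    unfolding regular_cells_eq
  proof (rule card_UN_disjoint)
    show "\<forall>n\<in>{n. n < len \<and> \<not> dark n}. \<forall>m\<in>{n. n < len \<and> \<not> dark n}. n \<noteq> m \<longrightarrow>
        up (Suc n) ` {..<sz (Suc n)} \<inter> up (Suc m) ` {..<sz (Suc m)} = {}"
    proof (intro ballI impI equals0I)
      fix n m r assume "n \<noteq> m" "r \<in> up (Suc n) ` {..<sz (Suc n)} \<inter> up (Suc m) ` {..<sz (Suc m)}"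
      then obtain k k' where k: "r = up (Suc n) k" "r = up (Suc m) k'" by blast
      have "offset (corner r) = - int (Suc n)" unfolding k(1) by (simp only: corner_up offset_cell)
      moreover have "offset (corner r) = - int (Suc m)"
        unfolding k(2) by (simp only: corner_up offset_cell)
      ultimately show False using \<open>n \<noteq> m\<close> by simp
    qed
  qed auto
  also have "\<dots> = (\<Sum>n\<in>{n. n < len \<and> \<not> dark n}. sz (Suc n))"
    by (intro sum.cong refl) (simp add: card_image inj_on_def)
  also have "int \<dots> = (\<Sum>n\<in>{0..<len}. of_bool (\<not> dark n) * (rt (Suc n) - lf (Suc n)))"
  proof -
    have "int (sz (Suc n)) = rt (Suc n) - lf (Suc n)" if "n < len" for n
      using lf_less_rt[of "Suc n"] that by (simp add: sz_def)
    hence "(\<Sum>n\<in>{n. n < len \<and> \<not> dark n}. int (sz (Suc n)))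
        = (\<Sum>n\<in>{n. n < len \<and> \<not> dark n}. rt (Suc n) - lf (Suc n))"
      by (intro sum.cong refl) blast
    also have "\<dots> = (\<Sum>n\<in>{0..<len}. of_bool (\<not> dark n) * (rt (Suc n) - lf (Suc n)))"
      by (rule sum.mono_neutral_cong_left) auto
    finally show ?thesis by simp
  qed
  also have "(\<Sum>n\<in>{0..<len}. of_bool (\<not> dark n) * (rt (Suc n) - lf (Suc n)))
      = black_count (rt 0 - lf 0) (map step_at [0..<len])"
  proof (rule inc_induct[of 0 len "\<lambda>m. (\<Sum>n\<in>{m..<len}. of_bool (\<not> dark n) * (rt (Suc n) - lf (Suc n)))
      = black_count (rt m - lf m) (map step_at [m..<len])"])
    fix m assume m: "m < len" "(\<Sum>n\<in>{Suc m..<len}. of_bool (\<not> dark n) * (rt (Suc n) - lf (Suc n)))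
      = black_count (rt (Suc m) - lf (Suc m)) (map step_at [Suc m..<len])"
    show "(\<Sum>n\<in>{m..<len}. of_bool (\<not> dark n) * (rt (Suc n) - lf (Suc n)))
      = black_count (rt m - lf m) (map step_at [m..<len])"
      unfolding sum.atLeast_Suc_lessThan[OF m(1)] m(2) upt_conv_Cons[OF m(1)]
      by (auto simp: step_at_def algebra_simps)
  qed auto
  finally show ?thesis by simp
qed

end

theorem theorem1p3:
  fixes a w :: nat and ds :: "nat list"
  assumes "0 < a" and "ds \<noteq> []" and "\<forall>d\<in>set ds. 0 < d"
    and "douglas_admissible a ds"
    and "douglas_width a ds = real w"
    and "snd (vertex_D a) = snd (vertex_B ds)"
  shows "real (num_tilings (douglas_region a ds))
           = 2 powr (real (card (regular_cells a ds)) - real w * (real w + 1) / 2)"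
proof -
  interpret douglas a ds
    using assms by unfold_locales auto
  let ?u = "map step_at [0..<len]"
  have rt: "rt len = int len - int a"
    using assms(6) by (simp add: vertex_B_eq vertex_D_def vertex_A_def)
  have S: "count_list ?u South = a" and E: "int (count_list ?u East) = rt len"
    using count_South[of len] count_East[of len] rt by simp_all
  have "dist (real_point (vertex_B ds)) (real_point (vertex_C a ds)) = sqrt (2 * (real_of_int (rt len))\<^sup>2)"
    by (simp add: vertex_C_def vertex_B_eq reflect_def real_point_def dist_Pair_Pair dist_real_def rt)
  also have "\<dots> = sqrt 2 * real_of_int (rt len)"
    using E by (simp add: real_sqrt_mult)
  finally have "real w = real_of_int (rt len)"
    using assms(5) by (simp add: douglas_width_def)
  hence w: "count_list ?u East = w" using E by linarith
  have "2 * int (card (regular_cells a ds)) = 2 * int (inversions ?u) + int w * (int w + 1)"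
    using black_count_eq[of 0 ?u] by (simp add: card_regular_cells S w)
  hence "2 * real (card (regular_cells a ds)) = 2 * real (inversions ?u) + real w * (real w + 1)"
    by (metis (mono_tags, opaque_lifting) of_int_add of_int_mult of_int_of_nat_eq of_int_1 of_int_numeral)
  hence "real (card (regular_cells a ds)) - real w * (real w + 1) / 2 = real (inversions ?u)"
    by simp
  moreover have "num_tilings (douglas_region a ds) = 2 ^ inversions ?u"
    unfolding douglas_region_eq num_tilings_region using routes_full[of ?u] by (simp add: S)
  ultimately show ?thesis by (simp add: powr_realpow)
qed

end
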